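(* Let $x_0\in\mathbb{R}^{n_x}$ and $u$ be an input trajectory. (1) If there exists $T>0$ such that for any $t\ge T$ $$\mathcal{C}(t,T,x(t-T),u)\succ 0,\qquad ( * )$$ then $u$ is a weakly persistent input trajectory at $x_0$. (2) Conversely, if $u$ is a weakly persistent input trajectory at $x_0$ and all the associated $\mathcal{K}$-functions $\kappa_t$ have finite sensitivity, then there exists $T>0$ such that for any $t\ge T$, $( * )$ holds.
   Context: Let $n_x,n_u,n_y$ be positive integers, $\mathbb{R}^+=[0,\infty)$, $U\subset\mathbb{R}^{n_u}$, and $f:\mathbb{R}^{n_x}\times\mathbb{R}^{n_u}\to\mathbb{R}^{n_x}$, $h:\mathbb{R}^{n_x}\times\mathbb{R}^{n_u}\to\mathbb{R}^{n_y}$ be twice continuously differentiable. The system is $\dot{x}=f(x,u)$, $y=h(x,u)$. An input trajectory is a piecewise continuous map $u:\mathbb{R}^+\to U$. Solutions are assumed to be uniquely defined at all times; $\phi_f(s_2;s_1,\xi,u)$ is the solution at time $s_2\ge s_1\ge 0$ starting from $\xi$ at time $s_1$ with input $u$. The reference trajectory is $x(t)=\phi_f(t;0,x_0,u)$. $\|\cdot\|$ is the Euclidean norm; $\overline{B}(a,R)$ is the closed Euclidean ball; $\succ$ is the strict Loewner order (positive definiteness). Cumulative output error: $l(t_1,t_2,\xi_1,\xi_2,u)=\int_{t_1}^{t_2}\|h(\phi_f(s;t_1,\xi_1,u),u(s))-h(\phi_f(s;t_1,\xi_2,u),u(s))\|^2\,\mathrm{d}s$ for $0\le t_1\le t_2$.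 A $\mathcal{K}$-function is a continuous strictly increasing $\kappa:\mathbb{R}^+\to\mathbb{R}$ with $\kappa(0)=0$. It has finite sensitivity if there is $r>0$ with $\inf_{0<\|\xi\|\le r}\kappa(\|\xi\|)/\|\xi\|^2>0$. $u$ is weakly persistent at $x_0$ if there exists $T>0$ such that for any $t\ge T$ there exist $R_t>0$ and a $\mathcal{K}$-function $\kappa_t$ (the associated $\mathcal{K}$-functions) such that for any $\xi_1,\xi_2\in\overline{B}(x(t-T),R_t)$: $l(t-T,t,\xi_1,\xi_2,u)\ge\kappa_t(\|\xi_1-\xi_2\|)$. Observability Grammian on $[t-T,t]$, $t\ge T$: half the Hessian of $l(t-T,t,x(t-T),\cdot,u)$ at $x(t-T)$, i.e. $$\mathcal{C}(t,T,x(t-T),u)=\int_{t-T}^{t}\Phi_f^{\top}H(x(s),u(s))^{\top}H(x(s),u(s))\Phi_f\,\mathrm{d}s,$$ where $H(x,u)=\mathrm{d}_xh(x,u)$ and $\Phi_f=\Phi_f(s;t-T,x(t-T),u)$ is the differential of $\xi\mapsto\phi_f(s;t-T,\xi,u)$ at $\xi=x(t-T)$. *)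

theory Defs
  imports "HOL-Analysis.Analysis"
begin

definition twice_cont_differentiable ::
    "('a::real_normed_vector \<Rightarrow> 'b::real_normed_vector) \<Rightarrow> bool" where
  "twice_cont_differentiable g \<longleftrightarrow>
     (\<exists>(g' :: 'a \<Rightarrow> 'a \<Rightarrow>\<^sub>L 'b) (g'' :: 'a \<Rightarrow> 'a \<Rightarrow>\<^sub>L 'a \<Rightarrow>\<^sub>L 'b).
        (\<forall>z. (g has_derivative blinfun_apply (g' z)) (at z)) \<and>
        (\<forall>z. (g' has_derivative blinfun_apply (g'' z)) (at z)) \<and>
        continuous_on UNIV g'')"

(* Functions on [0,\<infinity>) are total functions on the reals whose values at negative times are
   never used. Piecewise continuity is understood as usual: on each compact interval there are
   only finitely many discontinuities, and all one-sided limits exist. *)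
definition piecewise_continuous :: "(real \<Rightarrow> 'a::topological_space) \<Rightarrow> bool" where
  "piecewise_continuous u \<longleftrightarrow>
     (\<forall>b\<ge>0. finite {t \<in> {0..b}. \<not> continuous (at t within {0..}) u}) \<and>
     (\<forall>t\<ge>0. \<exists>L. (u \<longlongrightarrow> L) (at_right t)) \<and>
     (\<forall>t>0. \<exists>L. (u \<longlongrightarrow> L) (at_left t))"

definition input_trajectory :: "'u::topological_space set \<Rightarrow> (real \<Rightarrow> 'u) \<Rightarrow> bool" where
  "input_trajectory U u \<longleftrightarrow> (\<forall>t\<ge>0. u t \<in> U) \<and> piecewise_continuous u"

(* x solves x' = f(x,u) on [s1,\<infinity>) with x(s1) = \<xi>. As u may jump, x is continuous and
   the differential equation is imposed at the times at which u is continuous. *)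
definition is_solution ::
    "('x::real_normed_vector \<times> 'u::topological_space \<Rightarrow> 'x) \<Rightarrow> (real \<Rightarrow> 'u) \<Rightarrow> real \<Rightarrow> 'x \<Rightarrow> (real \<Rightarrow> 'x) \<Rightarrow> bool"
  where
  "is_solution f u s1 \<xi> x \<longleftrightarrow>
     continuous_on {s1..} x \<and> x s1 = \<xi> \<and>
     (\<forall>s\<ge>s1. continuous (at s within {s1..}) u \<longrightarrow>
        (x has_vector_derivative f (x s, u s)) (at s within {s1..}))"

definition uniquely_solvable ::
    "('x::real_normed_vector \<times> 'u::topological_space \<Rightarrow> 'x) \<Rightarrow> 'u set \<Rightarrow> bool" where
  "uniquely_solvable f U \<longleftrightarrow>
     (\<forall>u s1 \<xi>. input_trajectory U u \<longrightarrow> 0 \<le> s1 \<longrightarrow>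
        (\<exists>x. is_solution f u s1 \<xi> x \<and>
             (\<forall>y. is_solution f u s1 \<xi> y \<longrightarrow> (\<forall>s\<ge>s1. y s = x s))))"

(* flow f s2 s1 \<xi> u is \<phi>_f(s2; s1, \<xi>, u). It is meaningful for s2 \<ge> s1 \<ge> 0 when
   uniquely_solvable holds. *)
definition flow ::
    "('x::real_normed_vector \<times> 'u::topological_space \<Rightarrow> 'x) \<Rightarrow> real \<Rightarrow> real \<Rightarrow> 'x \<Rightarrow> (real \<Rightarrow> 'u) \<Rightarrow> 'x" where
  "flow f s2 s1 \<xi> u = (THE y. \<exists>x. is_solution f u s1 \<xi> x \<and> x s2 = y)"

definition output_error ::
    "('x::real_normed_vector \<times> 'u::topological_space \<Rightarrow> 'x) \<Rightarrow> ('x \<times> 'u \<Rightarrow> 'y::real_normed_vector) \<Rightarrow>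
     real \<Rightarrow> real \<Rightarrow> 'x \<Rightarrow> 'x \<Rightarrow> (real \<Rightarrow> 'u) \<Rightarrow> real" where
  "output_error f h t1 t2 \<xi>1 \<xi>2 u =
     integral {t1..t2}
       (\<lambda>s. (norm (h (flow f s t1 \<xi>1 u, u s) - h (flow f s t1 \<xi>2 u, u s)))\<^sup>2)"

definition K_function :: "(real \<Rightarrow> real) \<Rightarrow> bool" where
  "K_function \<kappa> \<longleftrightarrow> continuous_on {0..} \<kappa> \<and> strict_mono_on {0..} \<kappa> \<and> \<kappa> 0 = 0"

(* The variable z stands for the norm of a vector \<xi> with 0 < norm \<xi> \<le> r. For a K-function
   the infimum is taken over a nonempty set that is bounded below by 0. *)
definition finite_sensitivity :: "(real \<Rightarrow> real) \<Rightarrow> bool" where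
  "finite_sensitivity \<kappa> \<longleftrightarrow> (\<exists>r>0. (INF z\<in>{0<..r}. \<kappa> z / z\<^sup>2) > 0)"

definition weakly_persistent_with ::
    "('x::real_normed_vector \<times> 'u::topological_space \<Rightarrow> 'x) \<Rightarrow> ('x \<times> 'u \<Rightarrow> 'y::real_normed_vector) \<Rightarrow>
     'x \<Rightarrow> (real \<Rightarrow> 'u) \<Rightarrow> real \<Rightarrow> (real \<Rightarrow> real) \<Rightarrow> (real \<Rightarrow> real \<Rightarrow> real) \<Rightarrow> bool" where
  "weakly_persistent_with f h x0 u T R \<kappa> \<longleftrightarrow>
     T > 0 \<and>
     (\<forall>t\<ge>T. R t > 0 \<and> K_function (\<kappa> t) \<and>
        (\<forall>\<xi>1 \<in> cball (flow f (t - T) 0 x0 u) (R t). \<forall>\<xi>2 \<in> cball (flow f (t - T) 0 x0 u) (R t).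
           output_error f h (t - T) t \<xi>1 \<xi>2 u \<ge> \<kappa> t (norm (\<xi>1 - \<xi>2))))"

definition weakly_persistent ::
    "('x::real_normed_vector \<times> 'u::topological_space \<Rightarrow> 'x) \<Rightarrow> ('x \<times> 'u \<Rightarrow> 'y::real_normed_vector) \<Rightarrow>
     'x \<Rightarrow> (real \<Rightarrow> 'u) \<Rightarrow> bool" where
  "weakly_persistent f h x0 u \<longleftrightarrow> (\<exists>T R \<kappa>. weakly_persistent_with f h x0 u T R \<kappa>)"

definition flow_differential ::
    "((real^'n) \<times> 'u::topological_space \<Rightarrow> real^'n) \<Rightarrow> real \<Rightarrow> real \<Rightarrow> real^'n \<Rightarrow> (real \<Rightarrow> 'u) \<Rightarrow> real^'n^'n" where
  "flow_differential f s2 s1 \<xi> u = jacobian (\<lambda>\<zeta>. flow f s2 s1 \<zeta> u) (at \<xi>)"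

definition output_differential ::
    "((real^'n) \<times> 'u \<Rightarrow> real^'m) \<Rightarrow> real^'n \<Rightarrow> 'u \<Rightarrow> real^'n^'m" where
  "output_differential h x v = jacobian (\<lambda>z. h (z, v)) (at x)"

definition observability_grammian ::
    "((real^'n) \<times> 'u::topological_space \<Rightarrow> real^'n) \<Rightarrow> ((real^'n) \<times> 'u \<Rightarrow> real^'m) \<Rightarrow>
     real \<Rightarrow> real \<Rightarrow> real^'n \<Rightarrow> (real \<Rightarrow> 'u) \<Rightarrow> real^'n^'n" where
  "observability_grammian f h t T \<xi> u =
     integral {t - T..t}
       (\<lambda>s. let \<Phi> = flow_differential f s (t - T) \<xi> u;
                 H = output_differential h (flow f s (t - T) \<xi> u) (u s)
             in transpose \<Phi> ** transpose H ** H ** \<Phi>)"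

definition positive_definite :: "real^'n^'n \<Rightarrow> bool" where
  "positive_definite A \<longleftrightarrow> transpose A = A \<and> (\<forall>v. v \<noteq> 0 \<longrightarrow> v \<bullet> (A *v v) > 0)"

end

theory Submission
  imports Defs
begin

text \<open>
  On a fixed time window the difference of two output trajectories started near the reference state
  equals the linearized output plus an error that is small relative to the distance of the initial
  states, uniformly in time: the flow is strictly differentiable in the initial state. Squaring and
  integrating, the cumulative output error lies between half and twice the quadratic form of the
  Grammian, up to an arbitrarily small multiple of the squared distance. Positive definiteness thus
  gives a quadratic K-function, and a quadratic lower bound on the error gives positive
  definiteness.

  Strict differentiability does not need the linear variational equation to be solved first:
  Gronwall's inequality shows that the difference quotients of the flow along the coordinate
  directions approximate all increments of the flow near the reference state, hence are Cauchy,
  and their limit is the differential.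
\<close>

subsection \<open>Analysis off a finite set of times\<close>

text \<open>The fundamental theorem of calculus tolerates a finite exceptional set as long as
  \<open>g\<close> is continuous, so jumps of the input do not disturb monotonicity.\<close>

lemma nonincreasing_off_finite:
  fixes g :: "real \<Rightarrow> real"
  assumes "finite S" "a \<le> b" "continuous_on {a..b} g"
    and "\<And>s. s \<in> {a<..<b} - S \<Longrightarrow> \<exists>D\<le>0. (g has_real_derivative D) (at s)"
  shows "g b \<le> g a"
proof -
  obtain D where D: "\<And>s. s \<in> {a<..<b} - S \<Longrightarrow> D s \<le> 0 \<and> (g has_real_derivative D s) (at s)"
    using assms(4) by metis
  \<comment> \<open>Truncating with \<open>min\<close> changes nothing where \<open>D s\<close> is a
    derivative, and makes the integrand nonpositive also at the exceptional points and endpoints,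
    where \<open>D\<close> is unspecified.\<close>
  have "((\<lambda>s. min (D s) 0) has_integral (g b - g a)) {a..b}"
  proof (rule fundamental_theorem_of_calculus_interior_strong[OF assms(1,2) _ assms(3)])
    fix s assume "s \<in> {a<..<b} - S"
    then show "(g has_vector_derivative min (D s) 0) (at s)"
      using D[of s] by (simp add: has_real_derivative_iff_has_vector_derivative min_def)
  qed
  then have "g b - g a \<le> 0"
    by (rule has_integral_le[OF _ has_integral_0]) auto
  then show ?thesis by simp
qed

text \<open>The norm may fail to be differentiable at zero, so the argument uses the squared norm.
  Adding \<open>e\<^sup>2\<close> to it absorbs the mixed term \<open>2 * norm (w r) * e\<close>;
  the price is the rate \<open>2 * L + 1\<close> for squares.\<close>

lemma gronwall_off_finite:
  fixes w :: "real \<Rightarrow> 'a::real_inner"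
  assumes "finite S" and s: "s \<in> {a..b}" and cont: "continuous_on {a..b} w"
    and L: "0 \<le> L" and e: "0 \<le> e"
    and deriv: "\<And>s. s \<in> {a<..<b} - S \<Longrightarrow>
      \<exists>w'. (w has_vector_derivative w') (at s) \<and> norm w' \<le> L * norm (w s) + e"
  shows "norm (w s) \<le> (norm (w a) + e) * exp ((L + 1) * (s - a))"
proof -
  define g where "g r = (w r \<bullet> w r + e\<^sup>2) * exp (- (2 * L + 1) * (r - a))" for r
  have "g s \<le> g a"
  proof (rule nonincreasing_off_finite[where g = g, OF assms(1)])
    show "a \<le> s" using s by simp
    have "continuous_on {a..s} w" using s by (intro continuous_on_subset[OF cont]) auto
    then show "continuous_on {a..s} g" unfolding g_def by (intro continuous_intros)
  next
    fix r assume r: "r \<in> {a<..<s} - S"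
    then obtain w' where w': "(w has_vector_derivative w') (at r)" "norm w' \<le> L * norm (w r) + e"
      using deriv[of r] s by auto
    let ?E = "exp (- (2 * L + 1) * (r - a))"
    let ?D = "(2 * (w r \<bullet> w') - (2 * L + 1) * (w r \<bullet> w r + e\<^sup>2)) * ?E"
    have "((\<lambda>r. w r \<bullet> w r) has_real_derivative 2 * (w r \<bullet> w')) (at r)"
      using bounded_bilinear.has_vector_derivative[OF bounded_bilinear_inner w'(1) w'(1)]
      by (simp add: has_real_derivative_iff_has_vector_derivative inner_commute)
    then have "(g has_real_derivative ?D) (at r)"
      unfolding g_def by (auto intro!: derivative_eq_intros simp: algebra_simps)
    moreover have "?D \<le> 0"
    proof -
      have "w r \<bullet> w' \<le> norm (w r) * norm w'" by (rule norm_cauchy_schwarz)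
      also have "\<dots> \<le> norm (w r) * (L * norm (w r) + e)"
        by (rule mult_left_mono[OF w'(2)]) simp
      finally have "2 * (w r \<bullet> w') \<le> 2 * L * (norm (w r))\<^sup>2 + 2 * norm (w r) * e"
        by (simp add: algebra_simps power2_eq_square)
      also have "\<dots> \<le> 2 * L * (norm (w r))\<^sup>2 + ((norm (w r))\<^sup>2 + e\<^sup>2)"
        using sum_squares_bound[of "norm (w r)" e] by simp
      also have "\<dots> \<le> (2 * L + 1) * (w r \<bullet> w r + e\<^sup>2)"
        using L by (simp add: algebra_simps power2_norm_eq_inner)
      finally show ?thesis by (simp add: mult_le_0_iff)
    qed
    ultimately show "\<exists>D\<le>0. (g has_real_derivative D) (at r)" by blast
  qed
  then have "(norm (w s))\<^sup>2 + e\<^sup>2 \<le> ((norm (w a))\<^sup>2 + e\<^sup>2) * exp ((2 * L + 1) * (s - a))"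
    by (simp add: g_def power2_norm_eq_inner exp_minus field_simps exp_add exp_diff)
  \<comment> \<open>The rate \<open>2 * L + 1\<close> is rounded up to \<open>2 * (L + 1)\<close> so
    that the bound is a perfect square and the root can be taken.\<close>
  also have "\<dots> \<le> (norm (w a) + e)\<^sup>2 * (exp ((L + 1) * (s - a)))\<^sup>2"
    using s e by (intro mult_mono) (auto simp: power2_sum exp_double[symmetric] algebra_simps)
  finally have "(norm (w s))\<^sup>2 \<le> ((norm (w a) + e) * exp ((L + 1) * (s - a)))\<^sup>2"
    by (smt (verit) power_mult_distrib zero_le_power2)
  then show ?thesis
    by (rule power2_le_imp_le) (use e in simp)
qed

text \<open>Mean value inequality in the first variable with the second one frozen. Uniform
  continuity of \<open>g'\<close> on a compact ball makes \<open>d\<close> independent of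
  \<open>p\<close> and \<open>v\<close>, so one radius serves all times of a bounded trajectory and
  input.\<close>

lemma uniform_linearization_first:
  fixes g :: "'a::euclidean_space \<times> 'b::euclidean_space \<Rightarrow> 'c::real_normed_vector"
    and g' :: "'a \<times> 'b \<Rightarrow> ('a \<times> 'b) \<Rightarrow>\<^sub>L 'c"
  assumes deriv: "\<And>z. (g has_derivative blinfun_apply (g' z)) (at z)"
    and cont: "continuous_on UNIV g'" and "0 < \<epsilon>"
  shows "\<exists>d>0. \<forall>p v x y. norm (p, v) \<le> M \<longrightarrow> x \<in> cball p d \<longrightarrow> y \<in> cball p d \<longrightarrow>
           norm (g (x, v) - g (y, v) - g' (p, v) (x - y, 0)) \<le> \<epsilon> * norm (x - y)"
proof -
  have "uniformly_continuous_on (cball 0 (M + 1)) g'"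
    by (rule compact_uniformly_continuous) (use cont continuous_on_subset in auto)
  then obtain d0 where d0: "0 < d0"
    "\<And>z z'. z \<in> cball 0 (M + 1) \<Longrightarrow> z' \<in> cball 0 (M + 1) \<Longrightarrow> dist z' z < d0 \<Longrightarrow> dist (g' z') (g' z) < \<epsilon>"
    unfolding uniformly_continuous_on_def using \<open>0 < \<epsilon>\<close> by metis
  \<comment> \<open>The half turns the closed ball of radius \<open>d\<close> into distances
    strictly below \<open>d0\<close>; the cap at 1 keeps all points within the ball of radius
    \<open>M + 1\<close>.\<close>
  define d where "d = min (d0 / 2) 1"
  have "norm (g (x, v) - g (y, v) - g' (p, v) (x - y, 0)) \<le> \<epsilon> * norm (x - y)"
    if pv: "norm (p, v) \<le> M" and x: "x \<in> cball p d" and y: "y \<in> cball p d" for p v x y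
  proof -
    let ?G = "cball p d \<times> {v}"
    have "norm (g (x, v) - g (y, v) - g' (p, v) ((x, v) - (y, v))) \<le> norm ((x, v) - (y, v)) * \<epsilon>"
    proof (rule differentiable_bound_linearization[where S = ?G and f' = "\<lambda>z. blinfun_apply (g' z)"])
      fix t :: real assume "t \<in> {0..1}"
      then have "y + t *\<^sub>R (x - y) \<in> cball p d"
        using convexD_alt[OF convex_cball y x, of t] by (simp add: algebra_simps)
      then show "(y, v) + t *\<^sub>R ((x, v) - (y, v)) \<in> ?G" by simp
    next
      fix z assume z: "z \<in> ?G"
      then obtain q where q: "z = (q, v)" "q \<in> cball p d" by auto
      have dz: "dist z (p, v) \<le> d" using q by (simp add: dist_Pair_Pair dist_commute)
      have "norm z \<le> M + 1"
        using pv dz norm_triangle_sub[of z "(p, v)"] by (simp add: dist_norm d_def)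
      then have "dist (g' z) (g' (p, v)) < \<epsilon>"
        using d0(2)[of "(p, v)" z] pv dz \<open>0 < d0\<close> by (auto simp: d_def)
      then show "onorm (blinfun_apply (g' z) - blinfun_apply (g' (p, v))) \<le> \<epsilon>"
        by (simp add: dist_norm norm_blinfun.rep_eq minus_blinfun.rep_eq fun_diff_def)
      show "(g has_derivative blinfun_apply (g' z)) (at z within ?G)"
        by (rule has_derivative_at_withinI[OF deriv])
    qed (use \<open>0 < d0\<close> in \<open>auto simp: d_def\<close>)
    then show ?thesis by (simp add: norm_Pair mult.commute)
  qed
  moreover have "0 < d" using \<open>0 < d0\<close> by (simp add: d_def)
  ultimately show ?thesis by blast
qed

section \<open>Boundedness and integrability for piecewise continuous inputs\<close>

lemma piecewise_continuous_bounded: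
  fixes u :: "real \<Rightarrow> 'a::real_normed_vector"
  assumes "piecewise_continuous u" "0 \<le> a"
  shows "bounded (u ` {a..b})"
proof -
  \<comment> \<open>Near each time the one-sided limits control both sides, and the value
    \<open>u p\<close> is added separately because it may differ from both. Compactness of the
    interval then leaves finitely many local bounds.\<close>
  have "\<exists>d>0. \<exists>B. \<forall>s\<in>ball p d \<inter> {0..}. norm (u s) \<le> B" if p: "0 \<le> p" for p
  proof -
    obtain l where "(u \<longlongrightarrow> l) (at_right p)"
      using assms(1) p unfolding piecewise_continuous_def by blast
    then have "\<forall>\<^sub>F s in at_right p. dist (u s) l < 1" by (rule tendstoD) simp
    then obtain r where r: "p < r" "\<And>s. p < s \<Longrightarrow> s < r \<Longrightarrow> dist (u s) l < 1"
      unfolding eventually_at_right_field by blast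
    obtain q m where q: "q < p" "\<And>s. q < s \<Longrightarrow> s < p \<Longrightarrow> 0 \<le> s \<Longrightarrow> dist (u s) m < 1"
    proof (cases "p = 0")
      case True
      \<comment> \<open>No left limit is available at time 0; since only nonnegative times are
        tested, any negative \<open>q\<close> makes the requirement vacuous.\<close>
      then show ?thesis using that[of "-1"] by auto
    next
      case False
      then obtain m where "(u \<longlongrightarrow> m) (at_left p)"
        using assms(1) p unfolding piecewise_continuous_def by (metis less_eq_real_def)
      then have "\<forall>\<^sub>F s in at_left p. dist (u s) m < 1" by (rule tendstoD) simp
      then show ?thesis using that unfolding eventually_at_left_field by blast
    qed
    have "norm (u s) \<le> norm l + norm m + norm (u p) + 1"
      if s: "s \<in> ball p (min (r - p) (p - q)) \<inter> {0..}" for s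
    proof -
      consider "s = p" | "p < s" "s < r" | "q < s" "s < p"
        using s by (fastforce simp: dist_real_def)
      then show ?thesis
      proof cases
        case 1 then show ?thesis by (simp add: add_increasing)
      next
        case 2
        then have "norm (u s - l) < 1" using r(2) by (simp add: dist_norm)
        then show ?thesis
          using norm_triangle_sub[of "u s" l] norm_ge_zero[of m] norm_ge_zero[of "u p"] by linarith
      next
        case 3
        then have "norm (u s - m) < 1" using q(2) s by (simp add: dist_norm)
        then show ?thesis
          using norm_triangle_sub[of "u s" m] norm_ge_zero[of l] norm_ge_zero[of "u p"] by linarith
      qed
    qed
    then show ?thesis using r(1) q(1)
      by (intro exI[of _ "min (r - p) (p - q)"] conjI exI[of _ "norm l + norm m + norm (u p) + 1"]) auto
  qed
  then obtain d B where dB: "\<And>p. 0 \<le> p \<Longrightarrow> 0 < d p"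
    "\<And>p s. 0 \<le> p \<Longrightarrow> s \<in> ball p (d p) \<Longrightarrow> 0 \<le> s \<Longrightarrow> norm (u s) \<le> B p"
    by (metis IntI atLeast_iff)
  obtain K where K: "K \<subseteq> {a..b}" "finite K" "{a..b} \<subseteq> (\<Union>p\<in>K. ball p (d p))"
    by (rule compactE_image[of "{a..b}" "{a..b}" "\<lambda>p. ball p (d p)"])
       (use dB(1) assms(2) in \<open>auto intro!: bexI\<close>)
  have "norm (u s) \<le> (\<Sum>p\<in>K. \<bar>B p\<bar>)" if s: "s \<in> {a..b}" for s
  proof -
    obtain p where p: "p \<in> K" "s \<in> ball p (d p)" using K(3) s by blast
    then have "norm (u s) \<le> \<bar>B p\<bar>" using dB(2)[of p s] K(1) s assms(2) by fastforce
    also have "\<dots> \<le> (\<Sum>p\<in>K. \<bar>B p\<bar>)" using K(2) p(1) by (intro member_le_sum) auto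
    finally show ?thesis .
  qed
  then show ?thesis unfolding bounded_iff by blast
qed

lemma integrable_on_continuous_off_finite:
  fixes g :: "real \<Rightarrow> real"
  assumes "finite S" and cont: "\<And>s. s \<in> {a..b} - S \<Longrightarrow> continuous (at s within {a..b}) g"
    and bd: "bounded (g ` {a..b})"
  shows "g integrable_on {a..b}"
proof -
  obtain B where B: "\<And>s. s \<in> {a..b} \<Longrightarrow> norm (g s) \<le> B"
    using bd unfolding bounded_iff by blast
  have meas: "{a..b} - S \<in> sets lebesgue" using assms(1) by (simp add: finite_imp_closed sets.Diff)
  have "continuous_on ({a..b} - S) g"
    unfolding continuous_on_eq_continuous_within
    using cont continuous_within_subset by blast
  then have g: "g \<in> borel_measurable (lebesgue_on ({a..b} - S))"
    by (rule continuous_imp_measurable_on_sets_lebesgue[OF _ meas])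
  have const: "(\<lambda>_. B) integrable_on ({a..b} - S)"
    by (rule integrable_spike_set[where S = "{a..b}"])
       (auto intro!: negligible_subset[OF negligible_finite[OF assms(1)]])
  have "g integrable_on ({a..b} - S)"
    by (rule measurable_bounded_by_integrable_imp_integrable[OF g const B meas]) blast
  then show ?thesis
    by (rule integrable_spike_set)
       (auto intro!: negligible_subset[OF negligible_finite[OF assms(1)]])
qed

lemma integrable_on_compose_continuous:
  fixes k :: "'p::euclidean_space \<times> 'u::euclidean_space \<Rightarrow> real" and a b :: real
  assumes k: "continuous_on UNIV k" and c: "continuous_on {a..b} c" and "finite S"
    and u: "\<And>s. s \<in> {a..b} - S \<Longrightarrow> continuous (at s within {a..b}) u"
    and bd: "bounded (u ` {a..b})"
  shows "(\<lambda>s. k (c s, u s)) integrable_on {a..b}"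
proof (rule integrable_on_continuous_off_finite[OF \<open>finite S\<close>])
  fix s assume s: "s \<in> {a..b} - S"
  have "continuous (at s within {a..b}) (\<lambda>s. (c s, u s))"
    using s c u by (intro continuous_Pair) (auto simp: continuous_on_eq_continuous_within)
  moreover have "isCont k (c s, u s)" using k by (simp add: continuous_on_eq_continuous_at)
  ultimately show "continuous (at s within {a..b}) (\<lambda>s. k (c s, u s))"
    by (rule continuous_within_compose3[rotated])
next
  \<comment> \<open>The closure is taken because the range of a jumping input is bounded but need
    not be compact.\<close>
  let ?K = "c ` {a..b} \<times> closure (u ` {a..b})"
  have "compact ?K" using c bd by (intro compact_Times compact_continuous_image) auto
  then have "bounded (k ` ?K)"
    using k by (intro compact_imp_bounded compact_continuous_image) (auto intro: continuous_on_subset)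
  then show "bounded ((\<lambda>s. k (c s, u s)) ` {a..b})"
    by (rule bounded_subset) (auto intro!: imageI intro: subsetD[OF closure_subset])
qed

subsection \<open>Strict differentiability of flows in the initial state\<close>

text \<open>The exit time is the least element of the compact set of times at which the norm is at
  least \<open>d\<close>. It serves a continuation argument: estimates valid inside a tube hold at
  all times before \<open>\<tau>\<close>.\<close>

lemma exists_first_exit:
  fixes w :: "real \<Rightarrow> 'a::real_normed_vector"
  assumes "continuous_on {a..b} w" "r \<in> {a..b}" "d \<le> norm (w r)"
  obtains \<tau> where "\<tau> \<in> {a..b}" "d \<le> norm (w \<tau>)" "\<And>s. s \<in> {a..<\<tau>} \<Longrightarrow> norm (w s) < d"
proof -
  let ?B = "{s \<in> {a..b}. d \<le> norm (w s)}"
  have "closed ?B"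
    using assms(1) by (intro continuous_on_closed_Collect_le continuous_intros) auto
  moreover have "bounded ?B" by (rule bounded_subset[OF bounded_closed_interval[of a b]]) auto
  ultimately have "compact ?B" by (simp add: compact_eq_bounded_closed)
  moreover have "?B \<noteq> {}" using assms(2,3) by blast
  ultimately obtain \<tau> where \<tau>: "\<tau> \<in> ?B" "\<forall>s\<in>?B. \<tau> \<le> s"
    using compact_attains_inf[of ?B] by blast
  show ?thesis
  proof (rule that)
    fix s assume s: "s \<in> {a..<\<tau>}"
    show "norm (w s) < d"
    proof (rule ccontr)
      assume "\<not> norm (w s) < d"
      then have "s \<in> ?B" using s \<tau>(1) by simp
      then have "\<tau> \<le> s" using \<tau>(2) by blast
      then show False using s by simp
    qed
  qed (use \<tau>(1) in simp_all)
qed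

text \<open>
  \<open>\<xi>0\<close> is the initial state of the reference trajectory, \<open>A s\<close> is the differential of \<open>F s\<close> along it,
  and \<open>S\<close> contains the times at which the input jumps.
\<close>

locale uniformly_linearizable_ode =
  fixes F :: "real \<Rightarrow> 'x \<Rightarrow> 'x::euclidean_space"
    and A :: "real \<Rightarrow> 'x \<Rightarrow> 'x"
    and \<phi> :: "'x \<Rightarrow> real \<Rightarrow> 'x"
    and S :: "real set" and a b L :: real and \<xi>0 :: 'x
  assumes finite_S: "finite S"
    and linear_A: "linear (A s)"
    and L_nonneg: "0 \<le> L"
    and A_bound: "s \<in> {a..b} \<Longrightarrow> norm (A s v) \<le> L * norm v"
    and linearization: "0 < \<epsilon> \<Longrightarrow> \<exists>d>0. \<forall>s\<in>{a..b}. \<forall>x\<in>cball (\<phi> \<xi>0 s) d. \<forall>y\<in>cball (\<phi> \<xi>0 s) d.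
           norm (F s x - F s y - A s (x - y)) \<le> \<epsilon> * norm (x - y)"
    and \<phi>_cont: "continuous_on {a..b} (\<phi> \<xi>)"
    and \<phi>_init: "\<phi> \<xi> a = \<xi>"
    and \<phi>_deriv: "s \<in> {a<..<b} - S \<Longrightarrow> (\<phi> \<xi> has_vector_derivative F s (\<phi> \<xi> s)) (at s)"
begin

section \<open>Gronwall estimates in a tube around the reference trajectory\<close>

definition growth :: real where
  "growth = exp ((L + 2) * (b - a))"

lemma growth_pos: "0 < growth"
  by (simp add: growth_def)

text \<open>The rate \<open>L + 2\<close> in \<open>growth\<close> is the Lipschitz constant
  \<open>L + 1\<close> inside a tube plus the one lost in Gronwall's inequality. The end time
  \<open>c\<close> is left free so that the bound can be applied up to a first exit time.\<close>

lemma growth_bound: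
  fixes w :: "real \<Rightarrow> 'x"
  assumes s: "s \<in> {a..c}" and c: "c \<le> b" and cont: "continuous_on {a..c} w"
    and e: "0 \<le> e"
    and deriv: "\<And>s. s \<in> {a<..<c} - S \<Longrightarrow>
      \<exists>w'. (w has_vector_derivative w') (at s) \<and> norm w' \<le> (L + 1) * norm (w s) + e"
  shows "norm (w s) \<le> (norm (w a) + e) * growth"
proof -
  have "norm (w s) \<le> (norm (w a) + e) * exp ((L + 1 + 1) * (s - a))"
    using L_nonneg by (intro gronwall_off_finite[OF finite_S s cont _ e deriv]) auto
  also have "\<dots> \<le> (norm (w a) + e) * growth"
    unfolding growth_def using s c e L_nonneg by (intro mult_left_mono) (auto intro!: mult_mono)
  finally show ?thesis .
qed

lemma lipschitz_tube:
  obtains d where "0 < d" "\<And>s x y. s \<in> {a..b} \<Longrightarrow> x \<in> cball (\<phi> \<xi>0 s) d \<Longrightarrow> y \<in> cball (\<phi> \<xi>0 s) d \<Longrightarrow>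
    norm (F s x - F s y) \<le> (L + 1) * norm (x - y)"
proof -
  obtain d where d: "0 < d" "\<And>s x y. s \<in> {a..b} \<Longrightarrow> x \<in> cball (\<phi> \<xi>0 s) d \<Longrightarrow> y \<in> cball (\<phi> \<xi>0 s) d \<Longrightarrow>
      norm (F s x - F s y - A s (x - y)) \<le> 1 * norm (x - y)"
    using linearization[of 1] by auto
  have "norm (F s x - F s y) \<le> (L + 1) * norm (x - y)"
    if "s \<in> {a..b}" "x \<in> cball (\<phi> \<xi>0 s) d" "y \<in> cball (\<phi> \<xi>0 s) d" for s x y
    using d(2)[OF that] A_bound[OF that(1), of "x - y"]
      norm_triangle_sub[of "F s x - F s y" "A s (x - y)"] by (simp add: algebra_simps)
  then show ?thesis using that d(1) by blast
qed

text \<open>Continuation: before the first exit the Lipschitz bound of the tube is valid, so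
  Gronwall's inequality keeps the deviation at half the exit level, contradicting the exit.\<close>

lemma stays_in_tube:
  assumes "0 < d"
  shows "\<exists>R>0. \<forall>\<xi>\<in>cball \<xi>0 R. \<forall>s\<in>{a..b}. \<phi> \<xi> s \<in> cball (\<phi> \<xi>0 s) d"
proof -
  obtain d' where d': "0 < d'" "\<And>s x y. s \<in> {a..b} \<Longrightarrow> x \<in> cball (\<phi> \<xi>0 s) d' \<Longrightarrow> y \<in> cball (\<phi> \<xi>0 s) d' \<Longrightarrow>
      norm (F s x - F s y) \<le> (L + 1) * norm (x - y)"
    using lipschitz_tube by blast
  \<comment> \<open>The exit level is at most \<open>d'\<close> so that the Lipschitz bound applies
    before the exit, and at most \<open>d\<close> so that leaving the requested tube forces an
    exit.\<close>
  define D where "D = min d d'"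
  define R where "R = D / (2 * growth)"
  have D: "0 < D" "D \<le> d'" "D \<le> d" using assms d'(1) by (auto simp: D_def)
  have "\<phi> \<xi> s \<in> cball (\<phi> \<xi>0 s) d" if \<xi>: "\<xi> \<in> cball \<xi>0 R" and s: "s \<in> {a..b}" for \<xi> s
  proof (rule ccontr)
    assume "\<phi> \<xi> s \<notin> cball (\<phi> \<xi>0 s) d"
    then have out: "D \<le> norm (\<phi> \<xi> s - \<phi> \<xi>0 s)" using D by (simp add: dist_norm norm_minus_commute)
    have cont: "continuous_on {a..b} (\<lambda>s. \<phi> \<xi> s - \<phi> \<xi>0 s)" by (intro continuous_intros \<phi>_cont)
    obtain \<tau> where \<tau>: "\<tau> \<in> {a..b}" "D \<le> norm (\<phi> \<xi> \<tau> - \<phi> \<xi>0 \<tau>)"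
      and before: "\<And>s. s \<in> {a..<\<tau>} \<Longrightarrow> norm (\<phi> \<xi> s - \<phi> \<xi>0 s) < D"
      using exists_first_exit[OF cont s out] by blast
    have "norm (\<phi> \<xi> \<tau> - \<phi> \<xi>0 \<tau>) \<le> (norm (\<phi> \<xi> a - \<phi> \<xi>0 a) + 0) * growth"
    proof (rule growth_bound)
      show "continuous_on {a..\<tau>} (\<lambda>s. \<phi> \<xi> s - \<phi> \<xi>0 s)"
        using \<tau> by (intro continuous_on_subset[OF cont]) auto
    next
      fix r assume r: "r \<in> {a<..<\<tau>} - S"
      then have r': "r \<in> {a<..<b} - S" using \<tau> by auto
      have "norm (F r (\<phi> \<xi> r) - F r (\<phi> \<xi>0 r)) \<le> (L + 1) * norm (\<phi> \<xi> r - \<phi> \<xi>0 r)"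
        using before[of r] r r' D d'(1) by (intro d'(2)) (auto simp: dist_norm norm_minus_commute)
      then show "\<exists>w'. ((\<lambda>s. \<phi> \<xi> s - \<phi> \<xi>0 s) has_vector_derivative w') (at r) \<and>
          norm w' \<le> (L + 1) * norm (\<phi> \<xi> r - \<phi> \<xi>0 r) + 0"
        using has_vector_derivative_diff[OF \<phi>_deriv[OF r'] \<phi>_deriv[OF r']] by auto
    qed (use \<tau> in auto)
    also have "\<dots> \<le> R * growth"
      using \<xi> growth_pos by (simp add: \<phi>_init dist_norm norm_minus_commute)
    also have "\<dots> < D" using D growth_pos by (simp add: R_def)
    finally show False using \<tau>(2) by simp
  qed
  moreover have "0 < R" using D growth_pos by (simp add: R_def)
  ultimately show ?thesis by blast
qed

text \<open>Both solutions stay in a tube where the vector field is Lipschitz, so Gronwall's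
  inequality applies to their difference directly.\<close>

lemma flow_lipschitz:
  "\<exists>R>0. \<forall>\<xi>1\<in>cball \<xi>0 R. \<forall>\<xi>2\<in>cball \<xi>0 R. \<forall>s\<in>{a..b}.
     norm (\<phi> \<xi>1 s - \<phi> \<xi>2 s) \<le> growth * norm (\<xi>1 - \<xi>2)"
proof -
  obtain d where d: "0 < d" "\<And>s x y. s \<in> {a..b} \<Longrightarrow> x \<in> cball (\<phi> \<xi>0 s) d \<Longrightarrow> y \<in> cball (\<phi> \<xi>0 s) d \<Longrightarrow>
      norm (F s x - F s y) \<le> (L + 1) * norm (x - y)"
    using lipschitz_tube by blast
  obtain R where R: "0 < R" "\<And>\<xi> s. \<xi> \<in> cball \<xi>0 R \<Longrightarrow> s \<in> {a..b} \<Longrightarrow> \<phi> \<xi> s \<in> cball (\<phi> \<xi>0 s) d"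
    using stays_in_tube[OF d(1)] by blast
  have "norm (\<phi> \<xi>1 s - \<phi> \<xi>2 s) \<le> (norm (\<phi> \<xi>1 a - \<phi> \<xi>2 a) + 0) * growth"
    if \<xi>: "\<xi>1 \<in> cball \<xi>0 R" "\<xi>2 \<in> cball \<xi>0 R" and s: "s \<in> {a..b}" for \<xi>1 \<xi>2 s
  proof (rule growth_bound[OF s])
    fix r assume r: "r \<in> {a<..<b} - S"
    have "norm (F r (\<phi> \<xi>1 r) - F r (\<phi> \<xi>2 r)) \<le> (L + 1) * norm (\<phi> \<xi>1 r - \<phi> \<xi>2 r)"
      using r by (intro d(2) R(2) \<xi>) auto
    then show "\<exists>w'. ((\<lambda>s. \<phi> \<xi>1 s - \<phi> \<xi>2 s) has_vector_derivative w') (at r) \<and>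
        norm w' \<le> (L + 1) * norm (\<phi> \<xi>1 r - \<phi> \<xi>2 r) + 0"
      using has_vector_derivative_diff[OF \<phi>_deriv[OF r] \<phi>_deriv[OF r]] by auto
  qed (auto intro!: continuous_intros \<phi>_cont)
  then show ?thesis using R(1) by (auto simp: \<phi>_init mult.commute)
qed

section \<open>The differential of the flow as a limit of difference quotients\<close>

definition diff_quotient :: "real \<Rightarrow> real \<Rightarrow> 'x \<Rightarrow> 'x" where
  "diff_quotient k s v = (\<Sum>i\<in>Basis. (v \<bullet> i) *\<^sub>R ((\<phi> (\<xi>0 + k *\<^sub>R i) s - \<phi> \<xi>0 s) /\<^sub>R k))"

text \<open>Quotients are taken along \<open>Basis\<close> only and extended linearly, so linearity
  holds for every step \<open>k\<close> before any differentiability is known.\<close>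

lemma linear_diff_quotient: "linear (diff_quotient k s)"
proof (rule linearI)
  show "diff_quotient k s (v + w) = diff_quotient k s v + diff_quotient k s w" for v w
    unfolding diff_quotient_def by (simp only: inner_add_left scaleR_add_left sum.distrib)
  show "diff_quotient k s (c *\<^sub>R v) = c *\<^sub>R diff_quotient k s v" for c v
    unfolding diff_quotient_def by (simp only: inner_scaleR_left scaleR_sum_right scaleR_scaleR mult.assoc)
qed

text \<open>
  The error of the approximation vanishes at time \<open>a\<close> and solves the variational equation up to a
  small inhomogeneity, so Gronwall's inequality applies to it.
\<close>

lemma diff_quotient_approximates:
  assumes "0 < \<epsilon>"
  shows "\<exists>R>0. \<forall>k\<in>{0<..R}. \<forall>\<xi>1\<in>cball \<xi>0 R. \<forall>\<xi>2\<in>cball \<xi>0 R. \<forall>s\<in>{a..b}.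
     norm (\<phi> \<xi>1 s - \<phi> \<xi>2 s - diff_quotient k s (\<xi>1 - \<xi>2)) \<le> \<epsilon> * norm (\<xi>1 - \<xi>2)"
proof -
  \<comment> \<open>One factor \<open>growth\<close> is the Lipschitz constant of the flow, the
    other comes from Gronwall's inequality; the last factor counts the linearization errors, one for
    the pair \<open>\<xi>1\<close>, \<open>\<xi>2\<close> and one per coordinate direction.\<close>
  define K where "K = growth * growth * (1 + real (DIM('x)))"
  have K: "0 < K" using growth_pos by (simp add: K_def add_pos_nonneg)
  define \<eta> where "\<eta> = \<epsilon> / K"
  have \<eta>: "0 < \<eta>" using assms K by (simp add: \<eta>_def)
  obtain d where d: "0 < d" "\<And>s x y. s \<in> {a..b} \<Longrightarrow> x \<in> cball (\<phi> \<xi>0 s) d \<Longrightarrow> y \<in> cball (\<phi> \<xi>0 s) d \<Longrightarrow>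
      norm (F s x - F s y - A s (x - y)) \<le> \<eta> * norm (x - y)"
    using linearization[OF \<eta>] by blast
  obtain R1 where R1: "0 < R1" "\<And>\<xi> s. \<xi> \<in> cball \<xi>0 R1 \<Longrightarrow> s \<in> {a..b} \<Longrightarrow> \<phi> \<xi> s \<in> cball (\<phi> \<xi>0 s) d"
    using stays_in_tube[OF d(1)] by blast
  obtain R2 where R2: "0 < R2" "\<And>\<xi>1 \<xi>2 s. \<xi>1 \<in> cball \<xi>0 R2 \<Longrightarrow> \<xi>2 \<in> cball \<xi>0 R2 \<Longrightarrow> s \<in> {a..b} \<Longrightarrow>
      norm (\<phi> \<xi>1 s - \<phi> \<xi>2 s) \<le> growth * norm (\<xi>1 - \<xi>2)"
    using flow_lipschitz by blast
  define R where "R = min R1 R2"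
  define E where "E \<xi>1 \<xi>2 s = F s (\<phi> \<xi>1 s) - F s (\<phi> \<xi>2 s) - A s (\<phi> \<xi>1 s - \<phi> \<xi>2 s)" for \<xi>1 \<xi>2 s
  have E: "norm (E \<xi>1 \<xi>2 s) \<le> \<eta> * (growth * norm (\<xi>1 - \<xi>2))"
    if "\<xi>1 \<in> cball \<xi>0 R" "\<xi>2 \<in> cball \<xi>0 R" "s \<in> {a..b}" for \<xi>1 \<xi>2 s
  proof -
    have "norm (E \<xi>1 \<xi>2 s) \<le> \<eta> * norm (\<phi> \<xi>1 s - \<phi> \<xi>2 s)"
      unfolding E_def using that by (intro d(2) R1(2)) (auto simp: R_def)
    also have "\<dots> \<le> \<eta> * (growth * norm (\<xi>1 - \<xi>2))"
      using that \<eta> by (intro mult_left_mono R2(2)) (auto simp: R_def)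
    finally show ?thesis .
  qed
  have "norm (\<phi> \<xi>1 s - \<phi> \<xi>2 s - diff_quotient k s (\<xi>1 - \<xi>2)) \<le> \<epsilon> * norm (\<xi>1 - \<xi>2)"
    if k: "0 < k" "k \<le> R" and \<xi>: "\<xi>1 \<in> cball \<xi>0 R" "\<xi>2 \<in> cball \<xi>0 R" and s: "s \<in> {a..b}" for k \<xi>1 \<xi>2 s
  proof -
    define \<delta> where "\<delta> = \<xi>1 - \<xi>2"
    define w where "w s = \<phi> \<xi>1 s - \<phi> \<xi>2 s - diff_quotient k s \<delta>" for s
    let ?e = "\<eta> * growth * (1 + real (DIM('x))) * norm \<delta>"
    have shift: "\<xi>0 + k *\<^sub>R i \<in> cball \<xi>0 R" if "i \<in> Basis" for i
      using k that by (simp add: dist_norm)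
    have "norm (w s) \<le> (norm (w a) + ?e) * growth"
    proof (rule growth_bound[OF s])
      show "continuous_on {a..b} w"
        unfolding w_def diff_quotient_def by (intro continuous_intros \<phi>_cont)
      show "0 \<le> ?e" using \<eta> growth_pos by simp
    next
      fix r assume r: "r \<in> {a<..<b} - S"
      then have r': "r \<in> {a..b}" by auto
      let ?Q = "\<lambda>G :: 'x \<Rightarrow> 'x. \<Sum>i\<in>Basis. (\<delta> \<bullet> i) *\<^sub>R (G i /\<^sub>R k)"
      let ?w' = "F r (\<phi> \<xi>1 r) - F r (\<phi> \<xi>2 r) - ?Q (\<lambda>i. F r (\<phi> (\<xi>0 + k *\<^sub>R i) r) - F r (\<phi> \<xi>0 r))"
      have der: "(w has_vector_derivative ?w') (at r)"
        unfolding w_def diff_quotient_def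
        by (intro derivative_intros \<phi>_deriv[OF r]
            bounded_linear.has_vector_derivative[OF bounded_linear_scaleR_right])
      \<comment> \<open>By linearity \<open>A r\<close> commutes with the combination
        \<open>?Q\<close>, so all linear parts collect into \<open>A r (w r)\<close> and only
        linearization errors remain.\<close>
      have eq: "?w' = A r (w r) + (E \<xi>1 \<xi>2 r - ?Q (\<lambda>i. E (\<xi>0 + k *\<^sub>R i) \<xi>0 r))"
      proof -
        have "A r (w r) = A r (\<phi> \<xi>1 r - \<phi> \<xi>2 r) - ?Q (\<lambda>i. A r (\<phi> (\<xi>0 + k *\<^sub>R i) r - \<phi> \<xi>0 r))"
          unfolding w_def diff_quotient_def
          by (simp only: linear_diff[OF linear_A] linear_sum[OF linear_A] linear_cmul[OF linear_A])
        moreover have "?Q (\<lambda>i. E (\<xi>0 + k *\<^sub>R i) \<xi>0 r) =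
            ?Q (\<lambda>i. F r (\<phi> (\<xi>0 + k *\<^sub>R i) r) - F r (\<phi> \<xi>0 r)) -
            ?Q (\<lambda>i. A r (\<phi> (\<xi>0 + k *\<^sub>R i) r - \<phi> \<xi>0 r))"
          unfolding E_def by (simp only: scaleR_diff_right sum_subtractf)
        ultimately show ?thesis by (simp add: E_def)
      qed
      have nA: "norm (A r (w r)) \<le> (L + 1) * norm (w r)"
        unfolding distrib_right mult_1 using A_bound[OF r', of "w r"] norm_ge_zero[of "w r"] by linarith
      have nE: "norm (E \<xi>1 \<xi>2 r - ?Q (\<lambda>i. E (\<xi>0 + k *\<^sub>R i) \<xi>0 r)) \<le> ?e"
      proof -
        have "norm (?Q (\<lambda>i. E (\<xi>0 + k *\<^sub>R i) \<xi>0 r)) \<le> (\<Sum>i\<in>(Basis::'x set). norm \<delta> * (\<eta> * growth))"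
        proof (rule sum_norm_le)
          fix i :: 'x assume i: "i \<in> Basis"
          \<comment> \<open>The error is proportional to the step, so dividing by \<open>k\<close>
            leaves a bound that is uniform as \<open>k\<close> tends to 0.\<close>
          have "norm (E (\<xi>0 + k *\<^sub>R i) \<xi>0 r) \<le> \<eta> * (growth * k)"
            using E[OF shift[OF i] _ r', of \<xi>0] i k by simp
          then have "norm (E (\<xi>0 + k *\<^sub>R i) \<xi>0 r /\<^sub>R k) \<le> \<eta> * growth"
            using k by (simp add: field_simps)
          then show "norm ((\<delta> \<bullet> i) *\<^sub>R (E (\<xi>0 + k *\<^sub>R i) \<xi>0 r /\<^sub>R k)) \<le> norm \<delta> * (\<eta> * growth)"
            unfolding norm_scaleR[of "\<delta> \<bullet> i"] using Basis_le_norm[OF i] by (intro mult_mono) auto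
        qed
        moreover have "norm (E \<xi>1 \<xi>2 r) \<le> \<eta> * (growth * norm \<delta>)"
          unfolding \<delta>_def by (rule E[OF \<xi> r'])
        ultimately show ?thesis
          using norm_triangle_ineq4[of "E \<xi>1 \<xi>2 r" "?Q (\<lambda>i. E (\<xi>0 + k *\<^sub>R i) \<xi>0 r)"]
          by (simp add: algebra_simps)
      qed
      have "norm ?w' \<le> (L + 1) * norm (w r) + ?e"
        unfolding eq by (rule norm_triangle_mono[OF nA nE])
      then show "\<exists>w'. (w has_vector_derivative w') (at r) \<and> norm w' \<le> (L + 1) * norm (w r) + ?e"
        using der by blast
    qed simp
    \<comment> \<open>At the initial time the flow is the identity, so the difference quotient
      reproduces \<open>\<delta>\<close> exactly.\<close>
    moreover have "w a = 0"
      using k by (simp add: w_def diff_quotient_def \<phi>_init \<delta>_def euclidean_representation)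
    ultimately have "norm (w s) \<le> \<eta> * K * norm \<delta>" by (simp add: K_def algebra_simps)
    then show ?thesis using K by (simp add: w_def \<delta>_def \<eta>_def)
  qed
  moreover have "0 < R" using R1(1) R2(1) by (simp add: R_def)
  ultimately show ?thesis by (intro exI[of _ R]) auto
qed

definition flow_deriv :: "real \<Rightarrow> 'x \<Rightarrow> 'x" where
  "flow_deriv s v = lim (\<lambda>n. diff_quotient (inverse (real (Suc n))) s v)"

text \<open>Quotients with different small steps approximate the same increment of the flow, hence
  each other. The estimate is made for a short multiple of \<open>v\<close> and carried to
  \<open>v\<close> by linearity. Uniformity in \<open>s\<close> later gives continuity in
  time.\<close>

lemma diff_quotient_uniform_limit:
  "uniform_limit {a..b} (\<lambda>n s. diff_quotient (inverse (real (Suc n))) s v) (\<lambda>s. flow_deriv s v) sequentially"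
proof -
  have "uniformly_Cauchy_on {a..b} (\<lambda>n s. diff_quotient (inverse (real (Suc n))) s v)"
  proof (rule uniformly_Cauchy_onI)
    fix e :: real assume e: "0 < e"
    \<comment> \<open>Two approximation errors are added, whence the half; the summand 1 avoids
      division by zero and makes the final inequality strict.\<close>
    define \<epsilon> where "\<epsilon> = e / 2 / (norm v + 1)"
    have \<epsilon>: "0 < \<epsilon>" using e by (simp add: \<epsilon>_def add_nonneg_pos)
    obtain R where R: "0 < R" "\<And>k \<xi>1 \<xi>2 s. 0 < k \<Longrightarrow> k \<le> R \<Longrightarrow> \<xi>1 \<in> cball \<xi>0 R \<Longrightarrow> \<xi>2 \<in> cball \<xi>0 R \<Longrightarrow>
        s \<in> {a..b} \<Longrightarrow>
        norm (\<phi> \<xi>1 s - \<phi> \<xi>2 s - diff_quotient k s (\<xi>1 - \<xi>2)) \<le> \<epsilon> * norm (\<xi>1 - \<xi>2)"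
      using diff_quotient_approximates[OF \<epsilon>] by (metis greaterThanAtMost_iff)
    obtain N where N: "inverse (real (Suc N)) < R" using reals_Archimedean[OF R(1)] by blast
    have small: "inverse (real (Suc n)) \<le> R" if "N \<le> n" for n
    proof -
      have "inverse (real (Suc n)) \<le> inverse (real (Suc N))" using that by (intro le_imp_inverse_le) auto
      then show ?thesis using N by linarith
    qed
    \<comment> \<open>This scaling brings \<open>\<xi>0 + c *\<^sub>R v\<close> into the ball where
      the approximation is valid.\<close>
    define c where "c = R / (norm v + 1)"
    have c: "0 < c" using R(1) by (simp add: c_def add_nonneg_pos)
    have nz: "norm v + 1 \<noteq> 0" using norm_ge_zero[of v] by linarith
    have "c * norm v \<le> c * (norm v + 1)" using c by simp
    also have "\<dots> = R" using nz by (simp add: c_def)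
    finally have "c * norm v \<le> R" .
    then have cv: "\<xi>0 + c *\<^sub>R v \<in> cball \<xi>0 R" using c by (simp add: dist_norm)
    have "dist (diff_quotient (inverse (real (Suc m))) s v) (diff_quotient (inverse (real (Suc n))) s v) < e"
      if s: "s \<in> {a..b}" and "N \<le> m" "N \<le> n" for s m n
    proof -
      let ?D = "\<lambda>n. diff_quotient (inverse (real (Suc n))) s"
      have *: "norm (\<phi> (\<xi>0 + c *\<^sub>R v) s - \<phi> \<xi>0 s - c *\<^sub>R ?D n v) \<le> \<epsilon> * (c * norm v)" if "N \<le> n" for n
        using R(2)[OF _ small[OF that] cv _ s, of \<xi>0] c R(1)
        by (simp add: linear_cmul[OF linear_diff_quotient])
      have "c * norm (?D m v - ?D n v) = norm (c *\<^sub>R ?D m v - c *\<^sub>R ?D n v)"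
        using c by (simp flip: scaleR_diff_right)
      also have "\<dots> \<le> 2 * (\<epsilon> * (c * norm v))"
        using norm_triangle_ineq4[of "\<phi> (\<xi>0 + c *\<^sub>R v) s - \<phi> \<xi>0 s - c *\<^sub>R ?D n v"
            "\<phi> (\<xi>0 + c *\<^sub>R v) s - \<phi> \<xi>0 s - c *\<^sub>R ?D m v"] *[OF that(2)] *[OF that(3)]
        by simp
      also have "\<dots> = c * (2 * \<epsilon> * norm v)" by simp
      finally have "norm (?D m v - ?D n v) \<le> 2 * \<epsilon> * norm v" using c by simp
      also have "\<dots> < 2 * \<epsilon> * (norm v + 1)" using \<epsilon> by simp
      also have "\<dots> = e" using nz by (simp add: \<epsilon>_def del: distrib_left_numeral)
      finally show ?thesis by (simp add: dist_norm)
    qed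
    then show "\<exists>M. \<forall>s\<in>{a..b}. \<forall>m\<ge>M. \<forall>n\<ge>M.
        dist (diff_quotient (inverse (real (Suc m))) s v) (diff_quotient (inverse (real (Suc n))) s v) < e"
      by blast
  qed
  then have "uniformly_convergent_on {a..b} (\<lambda>n s. diff_quotient (inverse (real (Suc n))) s v)"
    by (rule Cauchy_uniformly_convergent)
  then show ?thesis
    by (simp add: uniformly_convergent_uniform_limit_iff flow_deriv_def)
qed

lemma diff_quotient_tendsto:
  "s \<in> {a..b} \<Longrightarrow> (\<lambda>n. diff_quotient (inverse (real (Suc n))) s v) \<longlonglongrightarrow> flow_deriv s v"
  by (rule tendsto_uniform_limitI[OF diff_quotient_uniform_limit])

lemma continuous_flow_deriv: "continuous_on {a..b} (\<lambda>s. flow_deriv s v)"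
proof (rule uniform_limit_theorem[OF _ diff_quotient_uniform_limit])
  show "\<forall>\<^sub>F n in sequentially. continuous_on {a..b} (\<lambda>s. diff_quotient (inverse (real (Suc n))) s v)"
    unfolding diff_quotient_def by (intro always_eventually allI continuous_intros \<phi>_cont)
qed simp

lemma linear_flow_deriv:
  assumes "s \<in> {a..b}"
  shows "linear (flow_deriv s)"
proof (rule linearI)
  let ?D = "\<lambda>n. diff_quotient (inverse (real (Suc n))) s"
  fix v w :: 'x and c :: real
  show "flow_deriv s (v + w) = flow_deriv s v + flow_deriv s w"
    using LIMSEQ_unique[OF diff_quotient_tendsto[OF assms, of "v + w"]]
      tendsto_add[OF diff_quotient_tendsto[OF assms, of v] diff_quotient_tendsto[OF assms, of w]]
    by (simp add: linear_add[OF linear_diff_quotient])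
  show "flow_deriv s (c *\<^sub>R v) = c *\<^sub>R flow_deriv s v"
    using LIMSEQ_unique[OF diff_quotient_tendsto[OF assms, of "c *\<^sub>R v"]]
      tendsto_scaleR[OF tendsto_const diff_quotient_tendsto[OF assms, of v], of c]
    by (simp add: linear_cmul[OF linear_diff_quotient])
qed

text \<open>The radius \<open>R\<close> works for all small steps at once, so the step can tend to 0
  with \<open>\<xi>1\<close>, \<open>\<xi>2\<close> and \<open>s\<close> fixed.\<close>

lemma flow_strictly_differentiable:
  assumes "0 < \<epsilon>"
  shows "\<exists>R>0. \<forall>\<xi>1\<in>cball \<xi>0 R. \<forall>\<xi>2\<in>cball \<xi>0 R. \<forall>s\<in>{a..b}.
     norm (\<phi> \<xi>1 s - \<phi> \<xi>2 s - flow_deriv s (\<xi>1 - \<xi>2)) \<le> \<epsilon> * norm (\<xi>1 - \<xi>2)"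
proof -
  obtain R where R: "0 < R" "\<And>k \<xi>1 \<xi>2 s. 0 < k \<Longrightarrow> k \<le> R \<Longrightarrow> \<xi>1 \<in> cball \<xi>0 R \<Longrightarrow> \<xi>2 \<in> cball \<xi>0 R \<Longrightarrow>
      s \<in> {a..b} \<Longrightarrow>
      norm (\<phi> \<xi>1 s - \<phi> \<xi>2 s - diff_quotient k s (\<xi>1 - \<xi>2)) \<le> \<epsilon> * norm (\<xi>1 - \<xi>2)"
    using diff_quotient_approximates[OF assms] by (metis greaterThanAtMost_iff)
  have "\<forall>\<^sub>F n in sequentially. inverse (real (Suc n)) < R"
    by (rule order_tendstoD(2)[OF LIMSEQ_inverse_real_of_nat R(1)])
  then have "norm (\<phi> \<xi>1 s - \<phi> \<xi>2 s - flow_deriv s (\<xi>1 - \<xi>2)) \<le> \<epsilon> * norm (\<xi>1 - \<xi>2)"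
    if \<xi>: "\<xi>1 \<in> cball \<xi>0 R" "\<xi>2 \<in> cball \<xi>0 R" and s: "s \<in> {a..b}" for \<xi>1 \<xi>2 s
    by (intro tendsto_upperbound[OF tendsto_norm[OF tendsto_diff[OF tendsto_const diff_quotient_tendsto[OF s]]]])
       (auto elim!: eventually_mono intro!: R(2) \<xi> s)
  then show ?thesis using R(1) by blast
qed

lemma flow_has_derivative:
  assumes s: "s \<in> {a..b}"
  shows "((\<lambda>\<xi>. \<phi> \<xi> s) has_derivative flow_deriv s) (at \<xi>0)"
  unfolding has_derivative_at_alt
proof (intro conjI allI impI)
  show "bounded_linear (flow_deriv s)" using linear_flow_deriv[OF s] by (simp add: linear_conv_bounded_linear)
  fix e :: real assume "0 < e"
  then obtain R where R: "0 < R" "\<And>\<xi>1 \<xi>2. \<xi>1 \<in> cball \<xi>0 R \<Longrightarrow> \<xi>2 \<in> cball \<xi>0 R \<Longrightarrow>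
      norm (\<phi> \<xi>1 s - \<phi> \<xi>2 s - flow_deriv s (\<xi>1 - \<xi>2)) \<le> e * norm (\<xi>1 - \<xi>2)"
    using flow_strictly_differentiable[OF \<open>0 < e\<close>] s by blast
  then have "norm (\<phi> y s - \<phi> \<xi>0 s - flow_deriv s (y - \<xi>0)) \<le> e * norm (y - \<xi>0)"
    if "norm (y - \<xi>0) < R" for y
    using that by (intro R(2)) (auto simp: dist_norm norm_minus_commute)
  then show "\<exists>d>0. \<forall>y. norm (y - \<xi>0) < d \<longrightarrow>
      norm (\<phi> y s - \<phi> \<xi>0 s - flow_deriv s (y - \<xi>0)) \<le> e * norm (y - \<xi>0)"
    using R(1) by blast
qed

end

subsection \<open>The output error and the observability Grammian\<close>

text \<open>Uniqueness makes the definite description in \<open>flow\<close> well defined, so it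
  agrees with the solution from \<open>s1\<close> onwards; the differential equation transfers along
  this agreement.\<close>

lemma flow_is_solution:
  assumes "uniquely_solvable f U" "input_trajectory U u" "0 \<le> s1"
  shows "is_solution f u s1 \<xi> (\<lambda>s. flow f s s1 \<xi> u)"
proof -
  obtain x where x: "is_solution f u s1 \<xi> x"
    and unique: "\<And>y s. is_solution f u s1 \<xi> y \<Longrightarrow> s1 \<le> s \<Longrightarrow> y s = x s"
    using assms unfolding uniquely_solvable_def by blast
  have flow: "flow f s s1 \<xi> u = x s" if "s1 \<le> s" for s
    unfolding flow_def
  proof (rule the_equality)
    show "\<exists>z. is_solution f u s1 \<xi> z \<and> z s = x s" using x by blast
    show "y = x s" if "\<exists>z. is_solution f u s1 \<xi> z \<and> z s = y" for y
      using that unique \<open>s1 \<le> s\<close> by blast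
  qed
  have "continuous_on {s1..} (\<lambda>s. flow f s s1 \<xi> u)"
    using x by (subst continuous_on_cong[OF refl, of _ _ x]) (auto simp: flow is_solution_def)
  moreover have "((\<lambda>s. flow f s s1 \<xi> u) has_vector_derivative f (flow f s s1 \<xi> u, u s)) (at s within {s1..})"
    if "s1 \<le> s" "continuous (at s within {s1..}) u" for s
  proof -
    have "(x has_vector_derivative f (x s, u s)) (at s within {s1..})"
      using x that by (simp add: is_solution_def)
    then show ?thesis
      unfolding flow[OF that(1)]
      by (rule has_vector_derivative_transform[rotated 2]) (use that(1) flow in simp_all)
  qed
  moreover have "flow f s1 s1 \<xi> u = \<xi>" using x flow[of s1] by (simp add: is_solution_def)
  ultimately show ?thesis unfolding is_solution_def by blast
qed

lemma bounded_blinfun_on_cball: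
  fixes g' :: "'a::euclidean_space \<Rightarrow> 'b::real_normed_vector \<Rightarrow>\<^sub>L 'c::real_normed_vector"
  assumes "continuous_on UNIV g'"
  obtains L where "0 \<le> L" "\<And>z v. norm z \<le> M \<Longrightarrow> norm (g' z v) \<le> L * norm v"
proof -
  have "bounded (g' ` cball 0 M)"
    using assms by (intro compact_imp_bounded compact_continuous_image) (auto intro: continuous_on_subset)
  then obtain L where L: "0 < L" "\<And>z. norm z \<le> M \<Longrightarrow> norm (g' z) \<le> L"
    unfolding bounded_pos by auto
  have "norm (g' z v) \<le> L * norm v" if "norm z \<le> M" for z v
    using norm_blinfun[of "g' z" v] mult_right_mono[OF L(2)[OF that], of "norm v"] by simp
  then show ?thesis using that[of L] L(1) by simp
qed

lemma twice_cont_differentiable_C1: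
  assumes "twice_cont_differentiable g"
  obtains g' where "\<And>z. (g has_derivative blinfun_apply (g' z)) (at z)" "continuous_on UNIV g'"
proof -
  obtain g' g'' where g': "\<And>z. (g has_derivative blinfun_apply (g' z)) (at z)"
    and g'': "\<And>z. (g' has_derivative blinfun_apply (g'' z)) (at z)"
    using assms unfolding twice_cont_differentiable_def by blast
  have "continuous_on UNIV g'"
    by (intro continuous_at_imp_continuous_on ballI has_derivative_continuous[OF g''])
  then show ?thesis by (rule that[OF g'])
qed

lemma jacobian_eq_matrix:
  "(g has_derivative g') (at x) \<Longrightarrow> jacobian g (at x) = matrix g'"
  unfolding jacobian_def by (drule frechet_derivative_at) simp

text \<open>The factor whose Gram matrix is the integrand of the Grammian: by the chain rule, in the
  smooth setting, the Jacobian of the output at time \<open>s\<close> with respect to the initial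
  state.\<close>

definition output_sensitivity ::
    "((real^'n) \<times> 'u::topological_space \<Rightarrow> real^'n) \<Rightarrow> ((real^'n) \<times> 'u \<Rightarrow> real^'m) \<Rightarrow>
     (real \<Rightarrow> 'u) \<Rightarrow> real \<Rightarrow> real^'n \<Rightarrow> real \<Rightarrow> real^'n^'m" where
  "output_sensitivity f h u a \<xi> s =
     output_differential h (flow f s a \<xi> u) (u s) ** flow_differential f s a \<xi> u"

text \<open>The three facts share one interpretation of the locale along the reference trajectory.
  Strict differentiability of the output combines that of the flow with the uniform linearization of
  \<open>h\<close>.\<close>

lemma output_linearization:
  fixes f :: "(real^'nx) \<times> (real^'nu) \<Rightarrow> real^'nx"
    and h :: "(real^'nx) \<times> (real^'nu) \<Rightarrow> real^'ny"
  assumes f: "twice_cont_differentiable f" and h: "twice_cont_differentiable h"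
    and us: "uniquely_solvable f U" and u: "input_trajectory U u" and a: "0 \<le> a" "a \<le> b"
  shows output_sensitivity_integrable:
      "(\<lambda>s. (output_sensitivity f h u a \<xi>0 s *v v) \<bullet> (output_sensitivity f h u a \<xi>0 s *v w))
         integrable_on {a..b}" (is ?int)
    and output_error_integrable:
      "(\<lambda>s. (norm (h (flow f s a \<xi>1 u, u s) - h (flow f s a \<xi>2 u, u s)))\<^sup>2) integrable_on {a..b}"
        (is ?err)
    and output_strictly_differentiable:
      "0 < \<epsilon> \<Longrightarrow> \<exists>R>0. \<forall>\<xi>1\<in>cball \<xi>0 R. \<forall>\<xi>2\<in>cball \<xi>0 R. \<forall>s\<in>{a..b}.
         norm (h (flow f s a \<xi>1 u, u s) - h (flow f s a \<xi>2 u, u s) -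
           output_sensitivity f h u a \<xi>0 s *v (\<xi>1 - \<xi>2)) \<le> \<epsilon> * norm (\<xi>1 - \<xi>2)" (is "_ \<Longrightarrow> ?lin")
proof -
  obtain f' where f': "\<And>z. (f has_derivative blinfun_apply (f' z)) (at z)" "continuous_on UNIV f'"
    using twice_cont_differentiable_C1[OF f] by blast
  obtain h' where h': "\<And>z. (h has_derivative blinfun_apply (h' z)) (at z)" "continuous_on UNIV h'"
    using twice_cont_differentiable_C1[OF h] by blast
  define \<phi> where "\<phi> \<xi> s = flow f s a \<xi> u" for \<xi> s
  define S where "S = {t \<in> {0..b}. \<not> continuous (at t within {0..}) u}"
  have S: "finite S"
    using u a by (simp add: S_def input_trajectory_def piecewise_continuous_def)
  \<comment> \<open>\<open>S\<close> refers to continuity within \<open>{0..}\<close>, while the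
    differential equation is imposed where \<open>u\<close> is continuous within
    \<open>{a..}\<close>; the former implies the latter.\<close>
  have u_cont: "continuous (at s within {a..}) u" if "s \<in> {a..b} - S" for s
    using that a by (auto simp: S_def intro: continuous_within_subset)
  then have u_cont': "continuous (at s within {a..b}) u" if "s \<in> {a..b} - S" for s
    using that continuous_within_subset[of s "{a..}" u "{a..b}"] by simp
  have sol: "is_solution f u a \<xi> (\<phi> \<xi>)" for \<xi>
    unfolding \<phi>_def by (rule flow_is_solution[OF us u a(1)])
  have \<phi>_cont: "continuous_on {a..b} (\<phi> \<xi>)" for \<xi>
    using sol[of \<xi>] unfolding is_solution_def by (auto intro: continuous_on_subset)
  have \<phi>_deriv: "(\<phi> \<xi> has_vector_derivative f (\<phi> \<xi> s, u s)) (at s)" if s: "s \<in> {a<..<b} - S" for \<xi> s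
  proof -
    have "s \<in> interior {a..}" using s by (simp add: interior_real_atLeast)
    moreover have "(\<phi> \<xi> has_vector_derivative f (\<phi> \<xi> s, u s)) (at s within {a..})"
      using sol[of \<xi>] s u_cont[of s] unfolding is_solution_def by auto
    ultimately show ?thesis using at_within_interior[of s "{a..}"] by simp
  qed
  have u_bd: "bounded (u ` {a..b})"
    using u a by (intro piecewise_continuous_bounded) (simp_all add: input_trajectory_def)
  have "bounded (\<phi> \<xi>0 ` {a..b} \<times> u ` {a..b})"
    by (intro bounded_Times u_bd compact_imp_bounded compact_continuous_image \<phi>_cont compact_Icc)
  then obtain M where "\<And>z. z \<in> \<phi> \<xi>0 ` {a..b} \<times> u ` {a..b} \<Longrightarrow> norm z \<le> M"
    unfolding bounded_iff by blast
  then have M: "norm (\<phi> \<xi>0 s, u s) \<le> M" if "s \<in> {a..b}" for s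
    using that by blast
  obtain L where L: "0 \<le> L" "\<And>z v. norm z \<le> M \<Longrightarrow> norm (f' z v) \<le> L * norm v"
    using bounded_blinfun_on_cball[OF f'(2), of M] by blast
  obtain K where K: "0 \<le> K" "\<And>z v. norm z \<le> M \<Longrightarrow> norm (h' z v) \<le> K * norm v"
    using bounded_blinfun_on_cball[OF h'(2), of M] by blast
  define F where "F s x = f (x, u s)" for s x
  define A where "A s v = f' (\<phi> \<xi>0 s, u s) (v, 0)" for s v
  interpret ode: uniformly_linearizable_ode F A \<phi> S a b L \<xi>0
  proof (rule uniformly_linearizable_ode.intro)
    show "linear (A s)" for s
    proof (rule linearI)
      show "A s (v + w) = A s v + A s w" for v w
        using blinfun.add_right[of "f' (\<phi> \<xi>0 s, u s)" "(v, 0)" "(w, 0)"] by (simp add: A_def)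
      show "A s (c *\<^sub>R v) = c *\<^sub>R A s v" for c v
        using blinfun.scaleR_right[of "f' (\<phi> \<xi>0 s, u s)" c "(v, 0)"] by (simp add: A_def)
    qed
    show "norm (A s v) \<le> L * norm v" if "s \<in> {a..b}" for s v
      using L(2)[OF M[OF that], of "(v, 0)"] by (simp add: A_def norm_Pair)
    show "\<exists>d>0. \<forall>s\<in>{a..b}. \<forall>x\<in>cball (\<phi> \<xi>0 s) d. \<forall>y\<in>cball (\<phi> \<xi>0 s) d.
        norm (F s x - F s y - A s (x - y)) \<le> \<epsilon> * norm (x - y)" if "0 < \<epsilon>" for \<epsilon>
      using uniform_linearization_first[OF f' that, of M] M unfolding F_def A_def by blast
    show "\<phi> \<xi> a = \<xi>" for \<xi>
      using sol[of \<xi>] by (simp add: is_solution_def)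
    show "(\<phi> \<xi> has_vector_derivative F s (\<phi> \<xi> s)) (at s)" if "s \<in> {a<..<b} - S" for s \<xi>
      unfolding F_def by (rule \<phi>_deriv[OF that])
  qed (use S L \<phi>_cont in auto)
  \<comment> \<open>This links the Jacobian matrices to the derivatives supplied by the locale and
    by \<open>h'\<close>.\<close>
  have sens: "output_sensitivity f h u a \<xi>0 s *v v = h' (\<phi> \<xi>0 s, u s) (ode.flow_deriv s v, 0)"
    if s: "s \<in> {a..b}" for s v
  proof -
    have "flow_differential f s a \<xi>0 u = matrix (ode.flow_deriv s)"
      using ode.flow_has_derivative[OF s]
      unfolding flow_differential_def \<phi>_def by (rule jacobian_eq_matrix)
    then have \<Phi>: "flow_differential f s a \<xi>0 u *v v = ode.flow_deriv s v"
      by (simp add: fun_cong[OF matrix_vector_mul(2)[OF ode.linear_flow_deriv[OF s]]])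
    let ?H = "\<lambda>x. h' (\<phi> \<xi>0 s, u s) (x, 0)"
    have "((\<lambda>z. h (z, u s)) has_derivative ?H) (at (\<phi> \<xi>0 s))"
      using has_derivative_compose[OF has_derivative_Pair[OF has_derivative_ident has_derivative_const]
        h'(1)[of "(\<phi> \<xi>0 s, u s)"]] by simp
    then have "output_differential h (\<phi> \<xi>0 s) (u s) = matrix ?H" "linear ?H"
      unfolding output_differential_def by (rule jacobian_eq_matrix, rule has_derivative_linear)
    then have "output_differential h (\<phi> \<xi>0 s) (u s) *v x = ?H x" for x
      using fun_cong[OF matrix_vector_mul(2)[of ?H], of x] by simp
    then show ?thesis
      by (simp add: output_sensitivity_def \<Phi> \<phi>_def flip: matrix_vector_mul_assoc)
  qed
  show ?int
  proof -
    \<comment> \<open>The integrand becomes a continuous function of a continuous curve and the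
      input, so that discontinuities can come only from \<open>u\<close>.\<close>
    define k where "k z = h' (fst (fst z), snd z) (fst (snd (fst z)), 0) \<bullet>
        h' (fst (fst z), snd z) (snd (snd (fst z)), 0)"
      for z :: "((real^'nx) \<times> (real^'nx) \<times> (real^'nx)) \<times> (real^'nu)"
    have "continuous_on UNIV k"
      unfolding k_def
      by (intro continuous_intros continuous_on_compose2[OF h'(2)]) auto
    then have "(\<lambda>s. k ((\<phi> \<xi>0 s, ode.flow_deriv s v, ode.flow_deriv s w), u s)) integrable_on {a..b}"
      by (rule integrable_on_compose_continuous[OF _ _ S u_cont' u_bd])
         (intro continuous_intros \<phi>_cont ode.continuous_flow_deriv)
    then show ?thesis
      by (rule integrable_eq) (simp add: k_def sens)
  qed
  show ?err
  proof -
    have h_cont: "continuous_on UNIV h"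
      by (intro continuous_at_imp_continuous_on ballI has_derivative_continuous[OF h'(1)])
    define k where "k z = (norm (h (fst (fst z), snd z) - h (snd (fst z), snd z)))\<^sup>2"
      for z :: "((real^'nx) \<times> (real^'nx)) \<times> (real^'nu)"
    have "continuous_on UNIV k"
      unfolding k_def by (intro continuous_intros continuous_on_compose2[OF h_cont]) auto
    then have "(\<lambda>s. k ((\<phi> \<xi>1 s, \<phi> \<xi>2 s), u s)) integrable_on {a..b}"
      by (rule integrable_on_compose_continuous[OF _ _ S u_cont' u_bd])
         (intro continuous_intros \<phi>_cont)
    then show ?thesis by (simp add: k_def \<phi>_def)
  qed
  show ?lin if "0 < \<epsilon>"
  proof -
    \<comment> \<open>The linearization error of \<open>h\<close> is multiplied by
      \<open>ode.growth\<close>, the error of the flow by the bound \<open>K\<close> of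
      \<open>h'\<close>; together they give \<open>\<epsilon>\<close>.\<close>
    define \<eta> where "\<eta> = \<epsilon> / (ode.growth + K)"
    have gK: "0 < ode.growth + K" using ode.growth_pos K(1) by simp
    then have \<eta>: "0 < \<eta>" using that by (simp add: \<eta>_def)
    obtain d where d: "0 < d" "\<And>p v x y. norm (p, v) \<le> M \<Longrightarrow> x \<in> cball p d \<Longrightarrow> y \<in> cball p d \<Longrightarrow>
        norm (h (x, v) - h (y, v) - h' (p, v) (x - y, 0)) \<le> \<eta> * norm (x - y)"
      using uniform_linearization_first[OF h' \<eta>, of M] by blast
    obtain R1 where R1: "0 < R1" "\<And>\<xi> s. \<xi> \<in> cball \<xi>0 R1 \<Longrightarrow> s \<in> {a..b} \<Longrightarrow> \<phi> \<xi> s \<in> cball (\<phi> \<xi>0 s) d"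
      using ode.stays_in_tube[OF d(1)] by blast
    obtain R2 where R2: "0 < R2" "\<And>\<xi>1 \<xi>2 s. \<xi>1 \<in> cball \<xi>0 R2 \<Longrightarrow> \<xi>2 \<in> cball \<xi>0 R2 \<Longrightarrow> s \<in> {a..b} \<Longrightarrow>
        norm (\<phi> \<xi>1 s - \<phi> \<xi>2 s) \<le> ode.growth * norm (\<xi>1 - \<xi>2)"
      using ode.flow_lipschitz by blast
    obtain R3 where R3: "0 < R3" "\<And>\<xi>1 \<xi>2 s. \<xi>1 \<in> cball \<xi>0 R3 \<Longrightarrow> \<xi>2 \<in> cball \<xi>0 R3 \<Longrightarrow> s \<in> {a..b} \<Longrightarrow>
        norm (\<phi> \<xi>1 s - \<phi> \<xi>2 s - ode.flow_deriv s (\<xi>1 - \<xi>2)) \<le> \<eta> * norm (\<xi>1 - \<xi>2)"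
      using ode.flow_strictly_differentiable[OF \<eta>] by blast
    define R where "R = min R1 (min R2 R3)"
    have "norm (h (\<phi> \<xi>1 s, u s) - h (\<phi> \<xi>2 s, u s) - output_sensitivity f h u a \<xi>0 s *v (\<xi>1 - \<xi>2))
        \<le> \<epsilon> * norm (\<xi>1 - \<xi>2)"
      if \<xi>: "\<xi>1 \<in> cball \<xi>0 R" "\<xi>2 \<in> cball \<xi>0 R" and s: "s \<in> {a..b}" for \<xi>1 \<xi>2 s
    proof -
      define w where "w = \<phi> \<xi>1 s - \<phi> \<xi>2 s"
      define q where "q = ode.flow_deriv s (\<xi>1 - \<xi>2)"
      let ?h' = "blinfun_apply (h' (\<phi> \<xi>0 s, u s))"
      have \<xi>R: "\<xi>1 \<in> cball \<xi>0 R1" "\<xi>2 \<in> cball \<xi>0 R1" "\<xi>1 \<in> cball \<xi>0 R2" "\<xi>2 \<in> cball \<xi>0 R2"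
        "\<xi>1 \<in> cball \<xi>0 R3" "\<xi>2 \<in> cball \<xi>0 R3"
        using \<xi> by (auto simp: R_def)
      have "norm (h (\<phi> \<xi>1 s, u s) - h (\<phi> \<xi>2 s, u s) - ?h' (w, 0)) \<le> \<eta> * norm w"
        unfolding w_def using \<xi>R s by (intro d(2) M R1(2))
      also have "\<dots> \<le> \<eta> * (ode.growth * norm (\<xi>1 - \<xi>2))"
        unfolding w_def using \<xi>R s \<eta> by (intro mult_left_mono R2(2)) auto
      finally have 1: "norm (h (\<phi> \<xi>1 s, u s) - h (\<phi> \<xi>2 s, u s) - ?h' (w, 0))
          \<le> \<eta> * (ode.growth * norm (\<xi>1 - \<xi>2))" .
      have "norm (?h' (w, 0) - ?h' (q, 0)) = norm (?h' (w - q, 0))"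
        using blinfun.diff_right[of "h' (\<phi> \<xi>0 s, u s)" "(w, 0)" "(q, 0)"] by simp
      also have "\<dots> \<le> K * norm (w - q)"
        using K(2)[OF M[OF s], of "(w - q, 0)"] by (simp add: norm_Pair)
      also have "\<dots> \<le> K * (\<eta> * norm (\<xi>1 - \<xi>2))"
        unfolding w_def q_def using \<xi>R s K(1) by (intro mult_left_mono R3(2))
      finally have 2: "norm (?h' (w, 0) - ?h' (q, 0)) \<le> K * (\<eta> * norm (\<xi>1 - \<xi>2))" .
      have "norm (h (\<phi> \<xi>1 s, u s) - h (\<phi> \<xi>2 s, u s) - ?h' (q, 0))
          \<le> \<eta> * (ode.growth * norm (\<xi>1 - \<xi>2)) + K * (\<eta> * norm (\<xi>1 - \<xi>2))"
        by (rule norm_diff_triangle_le[OF 1 2])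
      also have "\<dots> = \<eta> * (ode.growth + K) * norm (\<xi>1 - \<xi>2)" by (simp add: algebra_simps)
      also have "\<dots> = \<epsilon> * norm (\<xi>1 - \<xi>2)" using gK by (simp add: \<eta>_def)
      finally show ?thesis by (simp add: sens[OF s] q_def)
    qed
    moreover have "0 < R" using R1(1) R2(1) R3(1) by (simp add: R_def)
    ultimately show ?thesis unfolding \<phi>_def by blast
  qed
qed

section \<open>Integrals of Gram matrices and their quadratic forms\<close>

lemma inner_transpose_mult_self:
  fixes B :: "real^'n^'m"
  shows "v \<bullet> ((transpose B ** B) *v w) = (B *v v) \<bullet> (B *v w)"
  using dot_lmul_matrix[of v "transpose B" "B *v w"] by (simp add: matrix_vector_mul_assoc[symmetric])

text \<open>The entries of the Gram matrix are inner products of columns of \<open>B s\<close>;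
  off-diagonal entries are why the hypothesis takes two vectors. Once the matrix is integrable,
  bounded linear functionals pass through the integral.\<close>

lemma gram_integral:
  fixes B :: "real \<Rightarrow> real^'n^'m"
  assumes int: "\<And>v w. (\<lambda>s. (B s *v v) \<bullet> (B s *v w)) integrable_on T"
  defines "C \<equiv> integral T (\<lambda>s. transpose (B s) ** B s)"
  shows transpose_gram_integral: "transpose C = C"
    and inner_gram_integral: "v \<bullet> (C *v v) = integral T (\<lambda>s. (norm (B s *v v))\<^sup>2)"
proof -
  have "(\<lambda>s. transpose (B s) ** B s) integrable_on T"
  proof (rule integrable_componentwise)
    fix b :: "real^'n^'n" assume "b \<in> Basis"
    then obtain i j where b: "b = axis i (axis j 1)"
      by (auto simp: Basis_vec_def)
    have "(transpose (B s) ** B s) \<bullet> b = (B s *v axis i 1) \<bullet> (B s *v axis j 1)" for s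
      unfolding inner_transpose_mult_self[symmetric]
      by (simp add: b inner_axis inner_axis' matrix_vector_mult_basis column_def)
    then show "(\<lambda>s. (transpose (B s) ** B s) \<bullet> b) integrable_on T"
      using int by simp
  qed
  moreover have "bounded_linear (\<lambda>A :: real^'n^'n. v \<bullet> (A *v w))" for v w
    unfolding linear_conv_bounded_linear[symmetric]
    by (intro linearI) (simp_all add: matrix_vector_mult_add_rdistrib inner_add_right
        scaleR_matrix_vector_assoc[symmetric])
  ultimately have C: "v \<bullet> (C *v w) = integral T (\<lambda>s. (B s *v v) \<bullet> (B s *v w))" for v w
    unfolding C_def by (subst integral_linear[symmetric]) (auto simp: o_def inner_transpose_mult_self)
  have "axis i 1 \<bullet> (C *v axis j 1) = axis j 1 \<bullet> (C *v axis i 1)" for i j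
    unfolding C by (simp add: inner_commute)
  then show "transpose C = C"
    by (simp add: vec_eq_iff transpose_def inner_axis' matrix_vector_mult_basis column_def)
  show "v \<bullet> (C *v v) = integral T (\<lambda>s. (norm (B s *v v))\<^sup>2)"
    unfolding C by (simp add: power2_norm_eq_inner)
qed

lemma observability_grammian_eq:
  "observability_grammian f h t T \<xi> u = integral {t - T..t}
     (\<lambda>s. transpose (output_sensitivity f h u (t - T) \<xi> s) ** output_sensitivity f h u (t - T) \<xi> s)"
  by (simp add: observability_grammian_def output_sensitivity_def Let_def matrix_transpose_mul
      matrix_mul_assoc)

text \<open>Both bounds are the inequality \<open>(norm (x + y))\<^sup>2 \<le> 2 * (norm x)\<^sup>2
  + 2 * (norm y)\<^sup>2\<close>, once for \<open>p = q + (p - q)\<close> and once with the roles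
  exchanged.\<close>

lemma norm_squared_perturbation:
  fixes p q :: "'a::real_inner"
  assumes "norm (p - q) \<le> e"
  shows "(norm q)\<^sup>2 / 2 - e\<^sup>2 \<le> (norm p)\<^sup>2" and "(norm p)\<^sup>2 \<le> 2 * (norm q)\<^sup>2 + 2 * e\<^sup>2"
proof -
  have pq: "(norm (p - q))\<^sup>2 \<le> e\<^sup>2"
    using assms by (intro power_mono) auto
  have "(norm (x + y))\<^sup>2 \<le> 2 * (norm x)\<^sup>2 + 2 * (norm y)\<^sup>2" for x y :: 'a
  proof -
    have "(norm (x + y))\<^sup>2 \<le> (norm x + norm y)\<^sup>2" by (intro power_mono norm_triangle_ineq) auto
    then show ?thesis using sum_squares_bound[of "norm x" "norm y"] by (simp add: power2_sum)
  qed
  from this[of q "p - q"] this[of p "q - p"] pq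
  show "(norm q)\<^sup>2 / 2 - e\<^sup>2 \<le> (norm p)\<^sup>2" and "(norm p)\<^sup>2 \<le> 2 * (norm q)\<^sup>2 + 2 * e\<^sup>2"
    by (simp_all add: norm_minus_commute)
qed

text \<open>The pointwise perturbation bounds are integrated, with the output difference as
  \<open>p\<close> and the linearized output as \<open>q\<close>; the integral of the squared
  linearized output is the quadratic form of \<open>C\<close>.\<close>

lemma output_error_grammian:
  fixes f :: "(real^'nx) \<times> (real^'nu) \<Rightarrow> real^'nx"
    and h :: "(real^'nx) \<times> (real^'nu) \<Rightarrow> real^'ny"
    and \<xi>0 :: "real^'nx"
  assumes sys: "twice_cont_differentiable f" "twice_cont_differentiable h"
      "uniquely_solvable f U" "input_trajectory U u" and T: "0 < T" "T \<le> t" and \<epsilon>: "0 < \<epsilon>"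
  defines "C \<equiv> observability_grammian f h t T \<xi>0 u"
  shows "\<exists>R>0. \<forall>\<xi>1\<in>cball \<xi>0 R. \<forall>\<xi>2\<in>cball \<xi>0 R.
     (\<xi>1 - \<xi>2) \<bullet> (C *v (\<xi>1 - \<xi>2)) / 2 - \<epsilon> * (norm (\<xi>1 - \<xi>2))\<^sup>2 \<le> output_error f h (t - T) t \<xi>1 \<xi>2 u \<and>
     output_error f h (t - T) t \<xi>1 \<xi>2 u \<le> 2 * ((\<xi>1 - \<xi>2) \<bullet> (C *v (\<xi>1 - \<xi>2))) + \<epsilon> * (norm (\<xi>1 - \<xi>2))\<^sup>2"
proof -
  have a: "0 \<le> t - T" "t - T \<le> t" using T by auto
  let ?I = "{t - T..t}"
  define B where "B = output_sensitivity f h u (t - T) \<xi>0"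
  have B_int: "(\<lambda>s. (B s *v v) \<bullet> (B s *v w)) integrable_on ?I" for v w
    unfolding B_def by (rule output_sensitivity_integrable[OF sys a])
  have C: "v \<bullet> (C *v v) = integral ?I (\<lambda>s. (norm (B s *v v))\<^sup>2)" for v
    unfolding C_def observability_grammian_eq B_def
    by (rule inner_gram_integral[OF output_sensitivity_integrable[OF sys a]])
  \<comment> \<open>The upper bound accumulates \<open>2 * \<eta>\<^sup>2 * T\<close>, which this
    choice makes equal to \<open>\<epsilon>\<close>; the lower bound accumulates only half of
    it.\<close>
  define \<eta> where "\<eta> = sqrt (\<epsilon> / (2 * T))"
  have \<eta>: "0 < \<eta>" "\<eta>\<^sup>2 * T = \<epsilon> / 2" using \<epsilon> T by (simp_all add: \<eta>_def)
  obtain R where R: "0 < R" "\<And>\<xi>1 \<xi>2 s. \<xi>1 \<in> cball \<xi>0 R \<Longrightarrow> \<xi>2 \<in> cball \<xi>0 R \<Longrightarrow> s \<in> ?I \<Longrightarrow>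
      norm (h (flow f s (t - T) \<xi>1 u, u s) - h (flow f s (t - T) \<xi>2 u, u s) - B s *v (\<xi>1 - \<xi>2))
        \<le> \<eta> * norm (\<xi>1 - \<xi>2)"
    using output_strictly_differentiable[OF sys a \<eta>(1), of \<xi>0] unfolding B_def by blast
  have "\<delta> \<bullet> (C *v \<delta>) / 2 - \<epsilon> * (norm \<delta>)\<^sup>2 \<le> output_error f h (t - T) t \<xi>1 \<xi>2 u \<and>
      output_error f h (t - T) t \<xi>1 \<xi>2 u \<le> 2 * (\<delta> \<bullet> (C *v \<delta>)) + \<epsilon> * (norm \<delta>)\<^sup>2"
    if \<xi>: "\<xi>1 \<in> cball \<xi>0 R" "\<xi>2 \<in> cball \<xi>0 R" and \<delta>: "\<delta> = \<xi>1 - \<xi>2" for \<xi>1 \<xi>2 \<delta>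
  proof -
    define g where "g s = (norm (B s *v \<delta>))\<^sup>2" for s
    define l where "l s = (norm (h (flow f s (t - T) \<xi>1 u, u s) - h (flow f s (t - T) \<xi>2 u, u s)))\<^sup>2" for s
    define e where "e = (\<eta> * norm \<delta>)\<^sup>2"
    have g: "g integrable_on ?I" using B_int[of \<delta> \<delta>] unfolding g_def power2_norm_eq_inner .
    have l: "l integrable_on ?I" unfolding l_def by (rule output_error_integrable[OF sys a])
    have const: "((\<lambda>s. c) has_integral (c * T)) ?I" for c :: real
      using has_integral_const_real[of c "t - T" t] T by (simp add: mult.commute)
    have le: "g s / 2 - e \<le> l s" "l s \<le> 2 * g s + 2 * e" if "s \<in> ?I" for s
      using norm_squared_perturbation[OF R(2)[OF \<xi> that]] unfolding \<delta> g_def l_def e_def by auto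
    have eT: "e * T = \<epsilon> / 2 * (norm \<delta>)\<^sup>2"
      using \<eta>(2) by (simp add: e_def power_mult_distrib mult.assoc mult.commute)
    have "((\<lambda>s. g s / 2 - e) has_integral (integral ?I g / 2 - e * T)) ?I"
      by (intro has_integral_diff has_integral_divide integrable_integral g const)
    then have "integral ?I g / 2 - e * T \<le> integral ?I l"
      using integrable_integral[OF l] le(1) by (rule has_integral_le)
    moreover have "((\<lambda>s. 2 * g s + 2 * e) has_integral (2 * integral ?I g + 2 * e * T)) ?I"
      by (intro has_integral_add has_integral_mult_right integrable_integral g const)
    with integrable_integral[OF l] have "integral ?I l \<le> 2 * integral ?I g + 2 * e * T"
      using le(2) by (rule has_integral_le)
    moreover have "integral ?I g = \<delta> \<bullet> (C *v \<delta>)" unfolding C g_def ..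
    moreover have "integral ?I l = output_error f h (t - T) t \<xi>1 \<xi>2 u"
      unfolding output_error_def l_def ..
    moreover have "0 \<le> \<epsilon> * (norm \<delta>)\<^sup>2" using \<epsilon> by simp
    ultimately show ?thesis using eT by simp
  qed
  then show ?thesis using R(1) by blast
qed

lemma transpose_observability_grammian:
  fixes f :: "(real^'nx) \<times> (real^'nu) \<Rightarrow> real^'nx"
    and h :: "(real^'nx) \<times> (real^'nu) \<Rightarrow> real^'ny"
  assumes "twice_cont_differentiable f" "twice_cont_differentiable h"
      "uniquely_solvable f U" "input_trajectory U u" and T: "0 < T" "T \<le> t"
  shows "transpose (observability_grammian f h t T \<xi>0 u) = observability_grammian f h t T \<xi>0 u"
  unfolding observability_grammian_eq
  by (rule transpose_gram_integral[OF output_sensitivity_integrable[OF assms(1-4)]]) (use T in auto)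

section \<open>Quadratic lower bounds for forms and K-functions\<close>

lemma positive_definite_lower_bound:
  fixes A :: "real^'n^'n"
  assumes "positive_definite A"
  obtains c where "0 < c" "\<And>v. c * (norm v)\<^sup>2 \<le> v \<bullet> (A *v v)"
proof -
  have "continuous_on (sphere 0 1) (\<lambda>v. v \<bullet> (A *v v))"
    by (intro continuous_intros linear_continuous_on matrix_vector_mul_bounded_linear)
  moreover have "compact (sphere (0 :: real^'n) 1)" "sphere (0 :: real^'n) 1 \<noteq> {}" by auto
  ultimately obtain v0 where v0: "v0 \<in> sphere 0 1" "\<And>v. v \<in> sphere 0 1 \<Longrightarrow> v0 \<bullet> (A *v v0) \<le> v \<bullet> (A *v v)"
    using continuous_attains_inf[of "sphere 0 1" "\<lambda>v. v \<bullet> (A *v v)"] by blast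
  \<comment> \<open>The minimum over the unit sphere is the constant, extended to all vectors by
    homogeneity of degree two.\<close>
  have "v0 \<bullet> (A *v v0) * (norm v)\<^sup>2 \<le> v \<bullet> (A *v v)" for v
  proof (cases "v = 0")
    case False
    have "v0 \<bullet> (A *v v0) \<le> (v /\<^sub>R norm v) \<bullet> (A *v (v /\<^sub>R norm v))"
      using False by (intro v0(2)) simp
    also have "\<dots> = v \<bullet> (A *v v) / (norm v)\<^sup>2"
      by (simp add: matrix_vector_mult_scaleR divide_inverse power2_eq_square)
    finally show ?thesis using False by (simp add: pos_le_divide_eq)
  qed simp
  moreover have "v0 \<noteq> 0" using v0(1) by auto
  then have "0 < v0 \<bullet> (A *v v0)" using assms unfolding positive_definite_def by blast
  ultimately show ?thesis using that by blast
qed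

lemma finite_sensitivity_lower_bound:
  assumes "K_function \<kappa>" "finite_sensitivity \<kappa>"
  obtains r c where "0 < r" "0 < c" "\<And>z. 0 < z \<Longrightarrow> z \<le> r \<Longrightarrow> c * z\<^sup>2 \<le> \<kappa> z"
proof -
  obtain r where r: "0 < r" "0 < (INF z\<in>{0<..r}. \<kappa> z / z\<^sup>2)"
    using assms(2) unfolding finite_sensitivity_def by blast
  have "0 \<le> \<kappa> z / z\<^sup>2" if "0 < z" for z
    using assms(1) that strict_mono_onD[of "{0..}" \<kappa> 0 z] by (simp add: K_function_def)
  \<comment> \<open>A real infimum is a lower bound only for sets bounded below; monotonicity of
    \<open>\<kappa>\<close> from 0 supplies this.\<close>
  then have "bdd_below ((\<lambda>z. \<kappa> z / z\<^sup>2) ` {0<..r})" by (intro bdd_belowI2[of _ 0]) auto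
  then have "(INF z\<in>{0<..r}. \<kappa> z / z\<^sup>2) \<le> \<kappa> z / z\<^sup>2" if "0 < z" "z \<le> r" for z
    using that by (intro cINF_lower) auto
  then have "(INF z\<in>{0<..r}. \<kappa> z / z\<^sup>2) * z\<^sup>2 \<le> \<kappa> z" if "0 < z" "z \<le> r" for z
    using that by (simp add: pos_le_divide_eq)
  then show ?thesis using that r by blast
qed

lemma K_function_square: "0 < c \<Longrightarrow> K_function (\<lambda>z. c * z\<^sup>2)"
  unfolding K_function_def
  by (auto intro!: continuous_intros strict_mono_onI power_strict_mono)

theorem corollary4p8:
  fixes f :: "(real^'nx) \<times> (real^'nu) \<Rightarrow> real^'nx"
    and h :: "(real^'nx) \<times> (real^'nu) \<Rightarrow> real^'ny"
    and U :: "(real^'nu) set"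
    and x0 :: "real^'nx"
    and u :: "real \<Rightarrow> real^'nu"
  assumes "twice_cont_differentiable f"
    and "twice_cont_differentiable h"
    and "uniquely_solvable f U"
    and "input_trajectory U u"
  shows "((\<exists>T>0. \<forall>t\<ge>T.
             positive_definite (observability_grammian f h t T (flow f (t - T) 0 x0 u) u))
           \<longrightarrow> weakly_persistent f h x0 u) \<and>
         ((\<exists>T R \<kappa>. weakly_persistent_with f h x0 u T R \<kappa> \<and>
                    (\<forall>t\<ge>T. finite_sensitivity (\<kappa> t)))
           \<longrightarrow> (\<exists>T>0. \<forall>t\<ge>T.
                 positive_definite (observability_grammian f h t T (flow f (t - T) 0 x0 u) u)))"
proof (intro conjI impI)
  assume "\<exists>T>0. \<forall>t\<ge>T. positive_definite (observability_grammian f h t T (flow f (t - T) 0 x0 u) u)"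
  then obtain T where T: "0 < T"
    and pd: "\<And>t. T \<le> t \<Longrightarrow> positive_definite (observability_grammian f h t T (flow f (t - T) 0 x0 u) u)"
    by blast
  have "\<exists>R \<kappa>. 0 < R \<and> K_function \<kappa> \<and>
      (\<forall>\<xi>1 \<in> cball (flow f (t - T) 0 x0 u) R. \<forall>\<xi>2 \<in> cball (flow f (t - T) 0 x0 u) R.
         \<kappa> (norm (\<xi>1 - \<xi>2)) \<le> output_error f h (t - T) t \<xi>1 \<xi>2 u)" if t: "T \<le> t" for t
  proof -
    let ?\<xi> = "flow f (t - T) 0 x0 u"
    let ?C = "observability_grammian f h t T ?\<xi> u"
    obtain c where c: "0 < c" "\<And>v. c * (norm v)\<^sup>2 \<le> v \<bullet> (?C *v v)"
      using positive_definite_lower_bound[OF pd[OF t]] by blast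
    \<comment> \<open>Half the quadratic form contributes \<open>c / 2\<close>; giving up
      \<open>c / 4\<close> to the error leaves the coefficient \<open>c / 4\<close> for the
      K-function.\<close>
    then have "0 < c / 4" by simp
    from output_error_grammian[OF assms T t this, of ?\<xi>]
    obtain R where R: "0 < R" "\<And>\<xi>1 \<xi>2. \<xi>1 \<in> cball ?\<xi> R \<Longrightarrow> \<xi>2 \<in> cball ?\<xi> R \<Longrightarrow>
        (\<xi>1 - \<xi>2) \<bullet> (?C *v (\<xi>1 - \<xi>2)) / 2 - c / 4 * (norm (\<xi>1 - \<xi>2))\<^sup>2
          \<le> output_error f h (t - T) t \<xi>1 \<xi>2 u"
      by blast
    have "c / 4 * (norm (\<xi>1 - \<xi>2))\<^sup>2 \<le> output_error f h (t - T) t \<xi>1 \<xi>2 u"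
      if "\<xi>1 \<in> cball ?\<xi> R" "\<xi>2 \<in> cball ?\<xi> R" for \<xi>1 \<xi>2
      using R(2)[OF that] c(2)[of "\<xi>1 - \<xi>2"] by simp
    then show ?thesis
      using R(1) c(1) by (intro exI[of _ R] exI[of _ "\<lambda>z. c / 4 * z\<^sup>2"] conjI K_function_square) auto
  qed
  then obtain R \<kappa> where "\<And>t. T \<le> t \<Longrightarrow> 0 < R t \<and> K_function (\<kappa> t) \<and>
      (\<forall>\<xi>1 \<in> cball (flow f (t - T) 0 x0 u) (R t). \<forall>\<xi>2 \<in> cball (flow f (t - T) 0 x0 u) (R t).
         \<kappa> t (norm (\<xi>1 - \<xi>2)) \<le> output_error f h (t - T) t \<xi>1 \<xi>2 u)"
    by metis
  then have "weakly_persistent_with f h x0 u T R \<kappa>"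
    using T unfolding weakly_persistent_with_def by blast
  then show "weakly_persistent f h x0 u" unfolding weakly_persistent_def by blast
next
  assume "\<exists>T R \<kappa>. weakly_persistent_with f h x0 u T R \<kappa> \<and> (\<forall>t\<ge>T. finite_sensitivity (\<kappa> t))"
  then obtain T R \<kappa> where wp: "weakly_persistent_with f h x0 u T R \<kappa>"
    and fs: "\<And>t. T \<le> t \<Longrightarrow> finite_sensitivity (\<kappa> t)" by blast
  have T: "0 < T" using wp by (simp add: weakly_persistent_with_def)
  have "positive_definite (observability_grammian f h t T (flow f (t - T) 0 x0 u) u)" if t: "T \<le> t" for t
  proof -
    let ?\<xi> = "flow f (t - T) 0 x0 u"
    let ?C = "observability_grammian f h t T ?\<xi> u"
    have R: "0 < R t" and \<kappa>: "K_function (\<kappa> t)"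
      and err: "\<And>\<xi>1 \<xi>2. \<xi>1 \<in> cball ?\<xi> (R t) \<Longrightarrow> \<xi>2 \<in> cball ?\<xi> (R t) \<Longrightarrow>
        \<kappa> t (norm (\<xi>1 - \<xi>2)) \<le> output_error f h (t - T) t \<xi>1 \<xi>2 u"
      using wp t unfolding weakly_persistent_with_def by blast+
    obtain r c where rc: "0 < r" "0 < c" "\<And>z. 0 < z \<Longrightarrow> z \<le> r \<Longrightarrow> c * z\<^sup>2 \<le> \<kappa> t z"
      using finite_sensitivity_lower_bound[OF \<kappa> fs[OF t]] by blast
    \<comment> \<open>With this error the upper bound uses up only half of the quadratic lower bound
      \<open>c * \<rho>\<^sup>2\<close>, so the quadratic form must account for the rest.\<close>
    then have "0 < c / 2" by simp
    from output_error_grammian[OF assms T t this, of ?\<xi>]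
    obtain R' where R': "0 < R'" "\<And>\<xi>1 \<xi>2. \<xi>1 \<in> cball ?\<xi> R' \<Longrightarrow> \<xi>2 \<in> cball ?\<xi> R' \<Longrightarrow>
        output_error f h (t - T) t \<xi>1 \<xi>2 u
          \<le> 2 * ((\<xi>1 - \<xi>2) \<bullet> (?C *v (\<xi>1 - \<xi>2))) + c / 2 * (norm (\<xi>1 - \<xi>2))\<^sup>2"
      by blast
    define \<rho> where "\<rho> = min r (min (R t) R')"
    have \<rho>: "0 < \<rho>" "\<rho> \<le> r" "\<rho> \<le> R t" "\<rho> \<le> R'" using rc(1) R R'(1) by (auto simp: \<rho>_def)
    have "0 < v \<bullet> (?C *v v)" if v: "v \<noteq> 0" for v
    proof -
      \<comment> \<open>The vector is rescaled to length \<open>\<rho>\<close>, where sensitivity,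
        persistence and the Grammian estimate all apply, and the shifted state is compared with the
        reference state itself.\<close>
      define k where "k = \<rho> / norm v"
      have k: "0 < k" "norm (k *\<^sub>R v) = \<rho>" using \<rho>(1) v by (auto simp: k_def)
      have in_ball: "?\<xi> + k *\<^sub>R v \<in> cball ?\<xi> (R t)" "?\<xi> + k *\<^sub>R v \<in> cball ?\<xi> R'"
        "?\<xi> \<in> cball ?\<xi> (R t)" "?\<xi> \<in> cball ?\<xi> R'"
        using k(2) \<rho> R R'(1) by (auto simp: dist_norm)
      have "c * \<rho>\<^sup>2 \<le> \<kappa> t \<rho>" using rc(3) \<rho> by simp
      also have "\<dots> \<le> output_error f h (t - T) t (?\<xi> + k *\<^sub>R v) ?\<xi> u"
        using err[OF in_ball(1,3)] k(2) by simp
      also have "\<dots> \<le> 2 * ((k *\<^sub>R v) \<bullet> (?C *v (k *\<^sub>R v))) + c / 2 * \<rho>\<^sup>2"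
        using R'(2)[OF in_ball(2,4)] k(2) by simp
      finally have "c * \<rho>\<^sup>2 \<le> 4 * (k\<^sup>2 * (v \<bullet> (?C *v v)))"
        by (simp add: matrix_vector_mult_scaleR power2_eq_square mult.assoc)
      moreover have "0 < c * \<rho>\<^sup>2" using rc(2) \<rho>(1) by simp
      ultimately have "0 < k\<^sup>2 * (v \<bullet> (?C *v v))" by linarith
      then show ?thesis using k(1) by (simp add: zero_less_mult_iff)
    qed
    then show ?thesis
      unfolding positive_definite_def using transpose_observability_grammian[OF assms T t] by blast
  qed
  then show "\<exists>T>0. \<forall>t\<ge>T. positive_definite (observability_grammian f h t T (flow f (t - T) 0 x0 u) u)"
    using T by blast
qed

end
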